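(* Let $j \geq 0$ be a fixed integer and assume $\alpha > 0$. Let $\gamma_j$ be the positive random variable with $W[n,j]\sim \frac{1}{\Gamma(1+\alpha)}\gamma_j n^{\alpha}$ almost surely as $n\to\infty$. Then, in the $N$-interactions model, $$D[n,j] \sim \frac{1}{\Gamma(1+\alpha)}\,\frac{\alpha_2}{\alpha}\,\gamma_j\, n^{\alpha}\qquad\text{almost surely as } n\to\infty .$$
   Context: The $N$-interactions model. Fix an integer $N\ge 3$ and parameters $0<p\le 1$, $q,r\in[0,1]$. An $m$-clique is a complete graph on $m$ vertices, $K_m$. At time $n=0$ the graph is a single $K_N$; this graph and all of its cliques (in particular its vertices, its $(N-1)$-cliques and the $N$-clique itself) have initial weight $1$. At each step $n=1,2,\dots$ a set of $N$ vertices interacts: all non-existing edges between them are drawn, so that they form a $K_N$, and the weights of this $K_N$ and of all cliques contained in it are increased by $1$ (a clique that was never contained in the initial or an interacting $K_N$ has weight $0$). The $N$ interacting vertices are chosen, given the past, as follows. - With probability $p$ a new vertex is added, and it interacts with $N-1$ old vertices. With probability $r$ these are the vertices of an $(N-1)$-clique chosen from the existing $(N-1)$-cliques with probability proportional to weight (a clique of weight $w_t$ is chosen with probability $w_t/\sum_h w_h$); with probability $1-r$ they are a uniformly chosen $(N-1)$-element subset of the existing vertices. - With probability $1-p$ no new vertex is added and $N$ old vertices interact. With probability $q$ these are the vertices of an $N$-clique chosen from the existing $N$-cliques with probability proportional to weight; with probability $1-q$ they are a uniformly chosen $N$-element subset of the existing vertices. Constants: $\alpha_1=(1-p)q$, $\alpha_2=\frac{N-1}{N}pr$,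 $\alpha=\alpha_1+\alpha_2$. Labels: one of the $N$ initial vertices (fixed in advance) is labelled $0$; new vertices are labelled $1,2,\dots$ in the order in which they are added. $W[n,j]$ and $D[n,j]$ are the weight and the degree of the vertex labelled $j$ after the $n$th step, both equal to $0$ if this vertex does not yet exist after $n$ steps. For every $j\ge 0$ the limit $\gamma_j=\Gamma(1+\alpha)\lim_{n\to\infty}n^{-\alpha}W[n,j]$ exists and is positive almost surely when $\alpha>0$. $\Gamma$ is the Gamma function. The relation $X_n\sim c\,n^{\alpha}$ almost surely means $n^{-\alpha}X_n\to c$ almost surely. *)

theory Defs
  imports "HOL-Probability.Probability"
begin

text \<open>
  Vertices are integers: a nonnegative integer is the label of the vertex, and the initial vertices
  other than the one labelled 0 are the negative integers \<open>-1, \<dots>, 1 - N\<close>.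
  A weight is attached to every nonempty vertex set, vertices being singletons; the sets that were
  never contained in the initial or an interacting complete graph have weight 0.
\<close>

datatype wgraph = WGraph
  (vertices: "int set") (edges: "int set set") (weight: "int set \<Rightarrow> nat")

definition complete_edges :: "int set \<Rightarrow> int set set" where
  "complete_edges A = {e. e \<subseteq> A \<and> card e = 2}"

definition initial_graph :: "nat \<Rightarrow> wgraph" where
  "initial_graph N = (let A = {1 - int N..0} in
     WGraph A (complete_edges A) (\<lambda>C. if C \<noteq> {} \<and> C \<subseteq> A then 1 else 0))"

definition interact :: "int set \<Rightarrow> wgraph \<Rightarrow> wgraph" where
  "interact A G = WGraph (vertices G \<union> A) (edges G \<union> complete_edges A)
     (\<lambda>C. if C \<noteq> {} \<and> C \<subseteq> A then weight G C + 1 else weight G C)"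

definition vertex_subsets :: "nat \<Rightarrow> wgraph \<Rightarrow> int set set" where
  "vertex_subsets m G = {C. C \<subseteq> vertices G \<and> card C = m}"

definition cliques :: "nat \<Rightarrow> wgraph \<Rightarrow> int set set" where
  "cliques m G = {C \<in> vertex_subsets m G. complete_edges C \<subseteq> edges G}"

definition vertex_weight :: "wgraph \<Rightarrow> int \<Rightarrow> nat" where
  "vertex_weight G v = weight G {v}"

definition vertex_degree :: "wgraph \<Rightarrow> int \<Rightarrow> nat" where
  "vertex_degree G v = card {e \<in> edges G. v \<in> e}"

text \<open>The proper distribution proportional to \<open>w\<close> is obtained for finite \<open>A\<close> on which \<open>w\<close> is not
  identically 0, see the lemma below.\<close>

definition weighted_pmf :: "'b set \<Rightarrow> ('b \<Rightarrow> nat) \<Rightarrow> 'b pmf" where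
  "weighted_pmf A w = embed_pmf (\<lambda>x. if x \<in> A then real (w x) / (\<Sum>y\<in>A. real (w y)) else 0)"

lemma pmf_weighted_pmf:
  assumes "finite A" and "\<exists>y\<in>A. w y > 0"
  shows "pmf (weighted_pmf A w) x = (if x \<in> A then real (w x) / (\<Sum>y\<in>A. real (w y)) else 0)"
proof -
  let ?s = "\<Sum>y\<in>A. real (w y)"
  let ?f = "\<lambda>x. if x \<in> A then real (w x) / ?s else 0"
  have s: "?s > 0"
    using assms by (auto intro: sum_pos2)
  have "(\<integral>\<^sup>+ x. ennreal (?f x) \<partial>count_space UNIV) = (\<Sum>x\<in>A. ennreal (real (w x) / ?s))"
    using assms(1) by (subst nn_integral_count_space'[where A = A]) auto
  also have "\<dots> = ennreal (\<Sum>x\<in>A. real (w x) / ?s)"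
    using s by (intro sum_ennreal) auto
  also have "(\<Sum>x\<in>A. real (w x) / ?s) = 1"
    using s by (simp add: sum_divide_distrib[symmetric])
  finally show ?thesis
    unfolding weighted_pmf_def using s by (subst pmf_embed_pmf) auto
qed

text \<open>The label of the next new vertex is one more than the largest label present.\<close>

definition new_vertex :: "wgraph \<Rightarrow> int" where
  "new_vertex G = Max (vertices G) + 1"

text \<open>The law of the next interacting vertex set, given the current graph.\<close>

definition interacting_pmf :: "nat \<Rightarrow> real \<Rightarrow> real \<Rightarrow> real \<Rightarrow> wgraph \<Rightarrow> int set pmf" where
  "interacting_pmf N p q r G =
     bind_pmf (bernoulli_pmf p) (\<lambda>new.
       if new then
         bind_pmf (bernoulli_pmf r) (\<lambda>pref.
           map_pmf (insert (new_vertex G))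
             (if pref then weighted_pmf (cliques (N - 1) G) (weight G)
              else pmf_of_set (vertex_subsets (N - 1) G)))
       else
         bind_pmf (bernoulli_pmf q) (\<lambda>pref.
           if pref then weighted_pmf (cliques N G) (weight G)
           else pmf_of_set (vertex_subsets N G)))"

text \<open>The graph after \<open>n\<close> steps, where \<open>h n\<close> is the interacting set of step \<open>n \<ge> 1\<close>;
  \<open>h 0\<close> is irrelevant.\<close>

primrec graph_after :: "nat \<Rightarrow> (nat \<Rightarrow> int set) \<Rightarrow> nat \<Rightarrow> wgraph" where
  "graph_after N h 0 = initial_graph N"
| "graph_after N h (Suc n) = interact (h (Suc n)) (graph_after N h n)"

text \<open>\<open>S n\<close> is the random interacting set of step \<open>n \<ge> 1\<close>. As there are only countably many possible
  histories, the conditional law of a step given the past is expressed by the product rule for each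
  single history \<open>h\<close>.\<close>

locale N_interactions_model = prob_space M for M :: "'a measure" +
  fixes N :: nat and p q r :: real and S :: "nat \<Rightarrow> 'a \<Rightarrow> int set"
  assumes N_ge_3: "N \<ge> 3"
    and p_range: "0 < p" "p \<le> 1"
    and q_range: "0 \<le> q" "q \<le> 1"
    and r_range: "0 \<le> r" "r \<le> 1"
    and S_measurable: "\<And>n. n \<ge> 1 \<Longrightarrow> S n \<in> M \<rightarrow>\<^sub>M count_space {A. finite A \<and> card A = N}"
    and S_law: "\<And>n h A.
      prob {\<omega> \<in> space M. (\<forall>i\<in>{1..n}. S i \<omega> = h i) \<and> S (Suc n) \<omega> = A} =
      prob {\<omega> \<in> space M. \<forall>i\<in>{1..n}. S i \<omega> = h i} *
        pmf (interacting_pmf N p q r (graph_after N h n)) A"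

definition W :: "nat \<Rightarrow> (nat \<Rightarrow> 'a \<Rightarrow> int set) \<Rightarrow> nat \<Rightarrow> nat \<Rightarrow> 'a \<Rightarrow> nat" where
  "W N S n j \<omega> = vertex_weight (graph_after N (\<lambda>i. S i \<omega>) n) (int j)"

definition D :: "nat \<Rightarrow> (nat \<Rightarrow> 'a \<Rightarrow> int set) \<Rightarrow> nat \<Rightarrow> nat \<Rightarrow> 'a \<Rightarrow> nat" where
  "D N S n j \<omega> = vertex_degree (graph_after N (\<lambda>i. S i \<omega>) n) (int j)"

definition alpha1 :: "real \<Rightarrow> real \<Rightarrow> real" where
  "alpha1 p q = (1 - p) * q"

definition alpha2 :: "nat \<Rightarrow> real \<Rightarrow> real \<Rightarrow> real" where
  "alpha2 N p r = (real N - 1) / real N * p * r"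

definition alpha :: "nat \<Rightarrow> real \<Rightarrow> real \<Rightarrow> real \<Rightarrow> real" where
  "alpha N p q r = alpha1 p q + alpha2 N p r"

end

theory Submission
  imports Defs "HOL-Real_Asymp.Real_Asymp"
begin

text \<open>
  While the vertex \<open>v\<close> is present, a step raises its degree by exactly 1 if the new vertex joins a
  preferentially chosen \<open>(N - 1)\<close>-clique containing \<open>v\<close>, and leaves it unchanged if an existing
  \<open>N\<close>-clique interacts. Counting \<open>(N - 1)\<close>-subsets of the drawn cliques, the former has conditional
  probability \<open>\<alpha>\<^sub>2 W[n,v] / (n + 1)\<close>; the uniform choices contribute only \<open>O(1/n)\<close> because the number of
  vertices grows linearly. So the accumulated conditional means of the degree increments are
  asymptotic to \<open>(\<alpha>\<^sub>2 / \<alpha>) c n\<^sup>\<alpha>\<close> when \<open>W[n,v] \<sim> c n\<^sup>\<alpha>\<close>, by Stolz-Cesaro. Replacing the conditional means by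
  the increments themselves is a law of large numbers for bounded nonnegative increments: the
  difference is a martingale with second moment \<open>O(n\<^sup>\<alpha>)\<close>, hence \<open>o(n\<^sup>\<alpha>)\<close> along \<open>n = k\<^sup>m\<close> once \<open>m \<alpha> > 1\<close>,
  and monotonicity fills the gaps between these times. The bounds needed hold only on random events,
  so the increments are first truncated by conditions on the past.
\<close>

section \<open>Asymptotics of real sequences\<close>

text \<open>From some \<open>n0\<close> on each increment of \<open>a\<close> is within
  \<open>e / 2\<close> times the increment of \<open>b\<close> of its target; summing telescopes,
  and what happened up to \<open>n0\<close> is negligible because \<open>b\<close> is
  unbounded.\<close>

lemma stolz_cesaro:
  fixes a b :: "nat \<Rightarrow> real"
  assumes lim: "(\<lambda>n. (a (Suc n) - a n) / (b (Suc n) - b n)) \<longlonglongrightarrow> L"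
    and inc: "\<And>n. b n < b (Suc n)" and unb: "filterlim b at_top sequentially"
  shows "(\<lambda>n. a n / b n) \<longlonglongrightarrow> L"
proof (rule LIMSEQ_I)
  fix e :: real assume "e > 0"
  then obtain n0 where n0: "\<And>n. n \<ge> n0 \<Longrightarrow> \<bar>(a (Suc n) - a n) / (b (Suc n) - b n) - L\<bar> < e / 2"
    using LIMSEQ_D[OF lim, of "e / 2"] by (auto simp only: real_norm_def half_gt_zero)
  have incr: "\<bar>(a (Suc n) - a n) - L * (b (Suc n) - b n)\<bar> \<le> e / 2 * (b (Suc n) - b n)"
    if "n \<ge> n0" for n
  proof -
    have b: "b (Suc n) - b n > 0" using inc[of n] by simp
    have "(a (Suc n) - a n) - L * (b (Suc n) - b n)
        = ((a (Suc n) - a n) / (b (Suc n) - b n) - L) * (b (Suc n) - b n)"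
      unfolding left_diff_distrib[of "_ / _" L] using b by (subst nonzero_eq_divide_eq[THEN iffD1, OF _ refl]) auto
    also have "\<bar>\<dots>\<bar> = \<bar>(a (Suc n) - a n) / (b (Suc n) - b n) - L\<bar> * (b (Suc n) - b n)"
      using b by (simp add: abs_mult)
    also have "\<dots> \<le> e / 2 * (b (Suc n) - b n)"
      using b n0[OF that] by (intro mult_right_mono) auto
    finally show ?thesis .
  qed
  have tele: "\<bar>(a n - a n0) - L * (b n - b n0)\<bar> \<le> e / 2 * (b n - b n0)" if "n \<ge> n0" for n
    using that
  proof (induction rule: dec_induct)
    case (step n)
    have "(a (Suc n) - a n0) - L * (b (Suc n) - b n0)
        = ((a n - a n0) - L * (b n - b n0)) + ((a (Suc n) - a n) - L * (b (Suc n) - b n))"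
      by (simp add: right_diff_distrib)
    also have "\<bar>\<dots>\<bar> \<le> e / 2 * (b n - b n0) + e / 2 * (b (Suc n) - b n)"
      using step.IH incr[of n] step.hyps by linarith
    finally show ?case by (simp add: right_diff_distrib)
  qed simp
  \<comment> \<open>\<open>C\<close> collects the terms belonging to the fixed index
    \<open>n0\<close>; \<open>b n > 2 * C / e\<close> makes it smaller than half of
    \<open>e * b n\<close>.\<close>
  define C where "C = \<bar>a n0 - L * b n0\<bar> + e / 2 * \<bar>b n0\<bar>"
  have "\<forall>\<^sub>F n in sequentially. b n > max 0 (2 * C / e)"
    using unb unfolding filterlim_at_top_dense by blast
  then obtain n1 where n1: "\<And>n. n \<ge> n1 \<Longrightarrow> b n > max 0 (2 * C / e)"
    by (auto simp: eventually_sequentially)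
  have "\<bar>a n / b n - L\<bar> < e" if "n \<ge> max n0 n1" for n
  proof -
    have b: "b n > 0" "b n > 2 * C / e" using n1[of n] that by auto
    have "\<bar>a n - L * b n\<bar> \<le> \<bar>(a n - a n0) - L * (b n - b n0)\<bar> + \<bar>a n0 - L * b n0\<bar>"
      by (simp add: algebra_simps)
    also have "\<dots> \<le> e / 2 * (b n - b n0) + \<bar>a n0 - L * b n0\<bar>"
      using tele[of n] that by simp
    also have "e / 2 * (b n - b n0) \<le> e / 2 * b n + e / 2 * \<bar>b n0\<bar>"
      using mult_left_mono[OF abs_ge_minus_self[of "b n0"], of "e / 2"] \<open>e > 0\<close>
      by (simp add: right_diff_distrib)
    finally have "\<bar>a n - L * b n\<bar> \<le> C + e / 2 * b n"
      by (simp add: C_def)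
    also have "\<dots> < e * b n"
      using b \<open>e > 0\<close> by (simp add: field_simps)
    finally have "\<bar>a n - L * b n\<bar> / b n < e"
      using b by (simp add: field_simps)
    moreover have "\<bar>a n / b n - L\<bar> = \<bar>a n - L * b n\<bar> / b n"
      using b by (simp add: abs_if field_simps)
    ultimately show ?thesis by simp
  qed
  then show "\<exists>no. \<forall>n\<ge>no. norm (a n / b n - L) < e" unfolding real_norm_def by blast
qed

text \<open>Stolz-Cesaro with the denominators n^\<beta>, whose increments are asymptotic to \<beta>
  n^(\<beta> - 1); this is the source of the factor 1/\<beta>.\<close>

lemma tendsto_sum_div_powr:
  fixes d :: "nat \<Rightarrow> real"
  assumes \<beta>: "\<beta> > 0" and d: "(\<lambda>n. d n * real (Suc n) powr (1 - \<beta>)) \<longlonglongrightarrow> l"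
  shows "(\<lambda>n. (\<Sum>k<n. d k) / real n powr \<beta>) \<longlonglongrightarrow> l / \<beta>"
proof (rule stolz_cesaro)
  have "(\<lambda>n. real (Suc n) powr (\<beta> - 1) / (real (Suc n) powr \<beta> - real n powr \<beta>)) \<longlonglongrightarrow> inverse \<beta>"
    using \<beta> by real_asymp
  note * = tendsto_mult[OF d this]
  have "real (Suc n) powr (1 - \<beta>) * real (Suc n) powr (\<beta> - 1) = 1" for n
    by (simp flip: powr_add)
  then have "d n * real (Suc n) powr (1 - \<beta>) * (real (Suc n) powr (\<beta> - 1) / x) = d n / x" for n x
    by (metis mult.assoc mult.right_neutral times_divide_eq_right)
  from *[unfolded this]
  show "(\<lambda>n. ((\<Sum>k<Suc n. d k) - (\<Sum>k<n. d k)) / (real (Suc n) powr \<beta> - real n powr \<beta>)) \<longlonglongrightarrow> l / \<beta>"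
    by (simp add: divide_inverse)
  show "filterlim (\<lambda>n. real n powr \<beta>) at_top sequentially"
    using \<beta> by real_asymp
  show "real n powr \<beta> < real (Suc n) powr \<beta>" for n
    using \<beta> by (intro powr_less_mono2) auto
qed

text \<open>Between consecutive m-th powers a monotone sequence is trapped between its values at the
  ends, and the norming factors at the two ends have ratio tending to 1.\<close>

lemma tendsto_div_powr_of_power_subseq:
  fixes Y :: "nat \<Rightarrow> real"
  assumes \<beta>: "\<beta> > 0" and m: "m > 0" and "mono Y" and nonneg: "\<And>n. Y n \<ge> 0"
    and lim: "(\<lambda>k. Y (k ^ m) / real (k ^ m) powr \<beta>) \<longlonglongrightarrow> L"
  shows "(\<lambda>n. Y n / real n powr \<beta>) \<longlonglongrightarrow> L"
proof -
  \<comment> \<open>The integer part of the m-th root, so that n lies in the block from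
    \<open>k n ^ m\<close> to \<open>Suc (k n) ^ m\<close>.\<close>
  define k where "k n = nat \<lfloor>real n powr (1 / real m)\<rfloor>" for n
  have k_lim: "filterlim k at_top sequentially"
    unfolding k_def using m by real_asymp
  have le: "k n ^ m \<le> n" and lt: "n < Suc (k n) ^ m" if "n > 0" for n
  proof -
    have pw: "(real n powr (1 / real m)) ^ m = real n"
      using m that by (simp add: powr_realpow[symmetric] powr_powr)
    have "real (k n) \<le> real n powr (1 / real m)" by (simp add: k_def)
    then have "real (k n) ^ m \<le> (real n powr (1 / real m)) ^ m" by (intro power_mono) auto
    then show "k n ^ m \<le> n" unfolding pw by (metis of_nat_le_iff of_nat_power)
    have "real n powr (1 / real m) < real (Suc (k n))" 
      unfolding k_def by simp linarith
    then have "(real n powr (1 / real m)) ^ m < real (Suc (k n)) ^ m"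
      using m by (intro power_strict_mono) auto
    then show "n < Suc (k n) ^ m" unfolding pw by (metis of_nat_less_iff of_nat_power)
  qed
  let ?u = "\<lambda>k. Y (k ^ m) / real (k ^ m) powr \<beta>"
  let ?r = "\<lambda>k. (real (k ^ m) / real (Suc k ^ m)) powr \<beta>"
  have r: "?r \<longlonglongrightarrow> 1"
  proof -
    have "(\<lambda>k. real k / real (Suc k)) \<longlonglongrightarrow> 1" by real_asymp
    then have "(\<lambda>k. ((real k / real (Suc k)) ^ m) powr \<beta>) \<longlonglongrightarrow> (1 ^ m) powr \<beta>"
      by (intro tendsto_intros) auto
    then show ?thesis by (simp add: power_divide)
  qed
  have lower: "(\<lambda>n. ?u (k n) * ?r (k n)) \<longlonglongrightarrow> L"
    using filterlim_compose[OF tendsto_mult[OF lim r] k_lim] by simp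
  have "(\<lambda>k. ?u (Suc k) / ?r k) \<longlonglongrightarrow> L / 1"
    by (intro tendsto_divide r LIMSEQ_Suc[OF lim]) simp
  from filterlim_compose[OF this k_lim]
  have upper: "(\<lambda>n. ?u (Suc (k n)) / ?r (k n)) \<longlonglongrightarrow> L" by simp
  have ev: "\<forall>\<^sub>F n in sequentially. n > 0 \<and> k n > 0"
    using eventually_conj[OF eventually_gt_at_top[of 0] k_lim[unfolded filterlim_at_top, rule_format, of 1]]
    by eventually_elim auto
  show ?thesis
  proof (rule tendsto_sandwich[OF _ _ lower upper])
    show "\<forall>\<^sub>F n in sequentially. ?u (k n) * ?r (k n) \<le> Y n / real n powr \<beta>"
      using ev
    proof eventually_elim
      case (elim n)
      then have "?u (k n) * ?r (k n) = Y (k n ^ m) / real (Suc (k n) ^ m) powr \<beta>"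
        by (simp add: powr_divide)
      also have "\<dots> \<le> Y n / real n powr \<beta>"
        using elim le[of n] lt[of n] \<beta> nonneg less_imp_le[OF lt[of n]] 
        by (intro frac_le monoD[OF \<open>mono Y\<close>] powr_mono2) (auto simp del: power_Suc of_nat_power)
      finally show ?case .
    qed
    show "\<forall>\<^sub>F n in sequentially. Y n / real n powr \<beta> \<le> ?u (Suc (k n)) / ?r (k n)"
      using ev
    proof eventually_elim
      case (elim n)
      then have eq: "?u (Suc (k n)) / ?r (k n) = Y (Suc (k n) ^ m) / real (k n ^ m) powr \<beta>"
        by (simp add: powr_divide del: power_Suc of_nat_power)
      have "Y n / real n powr \<beta> \<le> Y (Suc (k n) ^ m) / real (k n ^ m) powr \<beta>"
        using elim le[of n] \<beta> nonneg less_imp_le[OF lt[of n]] 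
        by (intro frac_le monoD[OF \<open>mono Y\<close>] powr_mono2) (auto simp del: power_Suc of_nat_power)
      then show ?case unfolding eq .
    qed
  qed
qed

section \<open>Processes driven by a kernel on finite histories\<close>

text \<open>Histories are lists with the most recent entry first.\<close>

primrec path_pmf :: "('b list \<Rightarrow> 'b pmf) \<Rightarrow> nat \<Rightarrow> 'b list pmf" where
  "path_pmf K 0 = return_pmf []"
| "path_pmf K (Suc n) = bind_pmf (path_pmf K n) (\<lambda>xs. map_pmf (\<lambda>x. x # xs) (K xs))"

primrec path_sum :: "('b list \<Rightarrow> 'b \<Rightarrow> real) \<Rightarrow> 'b list \<Rightarrow> real" where
  "path_sum f [] = 0"
| "path_sum f (x # xs) = path_sum f xs + f xs x"

lemma path_sum_diff: "path_sum (\<lambda>xs x. f xs x - g xs x) xs = path_sum f xs - path_sum g xs"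
  by (induction xs) auto

lemma length_path_pmf: "xs \<in> set_pmf (path_pmf K n) \<Longrightarrow> length xs = n"
  by (induction n arbitrary: xs) auto

abbreviation mean :: "('b list \<Rightarrow> 'b pmf) \<Rightarrow> ('b list \<Rightarrow> 'b \<Rightarrow> real) \<Rightarrow> 'b list \<Rightarrow> real" where
  "mean K f xs \<equiv> measure_pmf.expectation (K xs) (f xs)"

lemma pmf_expectation_mono:
  fixes g h :: "'b \<Rightarrow> real"
  assumes "finite (set_pmf P)" "\<And>x. x \<in> set_pmf P \<Longrightarrow> g x \<le> h x"
  shows "measure_pmf.expectation P g \<le> measure_pmf.expectation P h"
  using assms by (intro integral_mono_AE integrable_measure_pmf_finite) (auto simp: AE_measure_pmf_iff)

text \<open>Finite supports turn all expectations into finite sums. They are demanded only at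
  histories of positive probability, since elsewhere the kernel may be an unspecified
  distribution.\<close>

locale finite_kernel =
  fixes K :: "'b list \<Rightarrow> 'b pmf"
  assumes finite_kernel: "\<And>n xs. xs \<in> set_pmf (path_pmf K n) \<Longrightarrow> finite (set_pmf (K xs))"
begin

lemma finite_path_pmf: "finite (set_pmf (path_pmf K n))"
  by (induction n) (auto simp: finite_kernel)

text \<open>The compensated sum is a martingale, so its second moment grows in each step by a
  conditional variance. As 0 <= f <= B, this variance is at most B times the conditional mean of
  f.\<close>

lemma path_pmf_second_moment:
  assumes f: "\<And>n xs x. xs \<in> set_pmf (path_pmf K n) \<Longrightarrow> x \<in> set_pmf (K xs) \<Longrightarrow> 0 \<le> f xs x \<and> f xs x \<le> B"
    and c: "\<And>n xs. xs \<in> set_pmf (path_pmf K n) \<Longrightarrow> mean K f xs \<le> c n"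
    and B: "B \<ge> 0"
  shows "measure_pmf.expectation (path_pmf K n) (\<lambda>xs. (path_sum (\<lambda>xs x. f xs x - mean K f xs) xs)\<^sup>2)
           \<le> B * (\<Sum>k<n. c k)"
proof (induction n)
  case (Suc n)
  let ?T = "path_sum (\<lambda>xs x. f xs x - mean K f xs)"
  let ?P = "path_pmf K n"
  note fin = finite_path_pmf[of n]
  have step: "measure_pmf.expectation (K xs) (\<lambda>x. (?T (x # xs))\<^sup>2) \<le> (?T xs)\<^sup>2 + B * c n"
    if xs: "xs \<in> set_pmf ?P" for xs
  proof -
    note int = integrable_measure_pmf_finite[OF finite_kernel[OF xs]]
    let ?a = "mean K f xs"
    \<comment> \<open>Sorted by powers of \<open>f xs x\<close>: the linear term integrates to a
      multiple of the mean \<open>?a\<close>, and the cross terms with \<open>?T xs\<close>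
      cancel.\<close>
    have "measure_pmf.expectation (K xs) (\<lambda>x. (?T (x # xs))\<^sup>2)
        = measure_pmf.expectation (K xs) (\<lambda>x. (?T xs)\<^sup>2 - 2 * ?a * ?T xs + ?a\<^sup>2 + (2 * ?T xs - 2 * ?a) * f xs x + (f xs x)\<^sup>2)"
      by (intro Bochner_Integration.integral_cong refl) (simp add: power2_eq_square algebra_simps)
    also have "\<dots> = (?T xs)\<^sup>2 - 2 * ?a * ?T xs + ?a\<^sup>2 + (2 * ?T xs - 2 * ?a) * ?a 
        + measure_pmf.expectation (K xs) (\<lambda>x. (f xs x)\<^sup>2)"
      by (subst Bochner_Integration.integral_add int; (rule int)?)+ simp
    also have "\<dots> = (?T xs)\<^sup>2 - ?a\<^sup>2 + measure_pmf.expectation (K xs) (\<lambda>x. (f xs x)\<^sup>2)"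
      by (simp add: power2_eq_square algebra_simps)
    also have "measure_pmf.expectation (K xs) (\<lambda>x. (f xs x)\<^sup>2) \<le> measure_pmf.expectation (K xs) (\<lambda>x. B * f xs x)"
      using f[OF xs] by (intro pmf_expectation_mono finite_kernel[OF xs]) (auto simp: power2_eq_square mult_right_mono)
    also have "\<dots> = B * ?a" by simp
    also have "\<dots> \<le> B * c n" using c[OF xs] B by (rule mult_left_mono)
    finally show ?thesis using zero_le_power2[of ?a] by linarith
  qed
  have "measure_pmf.expectation (path_pmf K (Suc n)) (\<lambda>xs. (?T xs)\<^sup>2)
      = (\<Sum>xs\<in>set_pmf ?P. pmf ?P xs * measure_pmf.expectation (K xs) (\<lambda>x. (?T (x # xs))\<^sup>2))"
    using finite_kernel by (simp add: pmf_expectation_bind[OF fin] del: path_sum.simps)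
  also have "\<dots> \<le> (\<Sum>xs\<in>set_pmf ?P. pmf ?P xs * ((?T xs)\<^sup>2 + B * c n))"
    by (intro sum_mono mult_left_mono step) auto
  also have "\<dots> = measure_pmf.expectation ?P (\<lambda>xs. (?T xs)\<^sup>2 + B * c n)"
    by (subst integral_measure_pmf[OF fin]) auto
  also have "\<dots> = measure_pmf.expectation ?P (\<lambda>xs. (?T xs)\<^sup>2) + B * c n"
    by (subst Bochner_Integration.integral_add) (auto intro: integrable_measure_pmf_finite fin)
  finally show ?case using Suc.IH by (simp add: distrib_left)
qed simp

end

section \<open>Almost sure comparison of sums with their accumulated conditional means\<close>

locale path_process = prob_space M + finite_kernel K
  for M :: "'a measure" and K :: "'b list \<Rightarrow> 'b pmf" +
  fixes hist :: "nat \<Rightarrow> 'a \<Rightarrow> 'b list"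
  assumes hist_Cons: "\<And>n \<omega>. \<exists>x. hist (Suc n) \<omega> = x # hist n \<omega>"
    and hist_measurable [measurable]: "\<And>n. hist n \<in> M \<rightarrow>\<^sub>M count_space UNIV"
    and distr_hist: "\<And>n. distr M (count_space UNIV) (hist n) = measure_pmf (path_pmf K n)"
begin

lemma AE_hist: "AE \<omega> in M. \<forall>n. hist n \<omega> \<in> set_pmf (path_pmf K n)"
proof (subst AE_all_countable, intro allI)
  fix n
  have "AE xs in distr M (count_space UNIV) (hist n). xs \<in> set_pmf (path_pmf K n)"
    unfolding distr_hist by (rule AE_pmfI)
  then show "AE \<omega> in M. hist n \<omega> \<in> set_pmf (path_pmf K n)"
    by (subst (asm) AE_distr_iff) auto
qed

lemma nn_integral_hist:
  "(\<integral>\<^sup>+\<omega>. g (hist n \<omega>) \<partial>M) = (\<integral>\<^sup>+xs. g xs \<partial>path_pmf K n)"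
  by (subst distr_hist[symmetric], subst nn_integral_distr) auto

lemma path_sum_mono:
  assumes hist: "\<And>n. hist n \<omega> \<in> set_pmf (path_pmf K n)"
    and f: "\<And>n xs x. xs \<in> set_pmf (path_pmf K n) \<Longrightarrow> x \<in> set_pmf (K xs) \<Longrightarrow> 0 \<le> f xs x"
  shows "mono (\<lambda>n. path_sum f (hist n \<omega>))" and "path_sum f (hist n \<omega>) \<ge> 0"
proof -
  have *: "path_sum f (hist n \<omega>) \<le> path_sum f (hist (Suc n) \<omega>)" for n
  proof -
    obtain x where x: "hist (Suc n) \<omega> = x # hist n \<omega>" using hist_Cons by blast
    then have "hist n \<omega> \<in> set_pmf (path_pmf K n)" "x \<in> set_pmf (K (hist n \<omega>))"
      using hist[of n] hist[of "Suc n"] by auto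
    then show ?thesis using f[of "hist n \<omega>" n x] x by simp
  qed
  then show "mono (\<lambda>n. path_sum f (hist n \<omega>))" by (intro incseq_SucI)
  from monoD[OF this, of 0 n] hist[of 0] show "path_sum f (hist n \<omega>) \<ge> 0" by simp
qed

text \<open>Along the times k^m the second moments of the normalised martingale are summable, so
  their squares have an almost surely finite sum and tend to 0; monotonicity of the sum of f does
  the rest. The quantifier over L stands inside the almost sure statement because the limit may
  depend on \<omega>.\<close>

theorem path_sum_asymp_mean:
  assumes f: "\<And>n xs x. xs \<in> set_pmf (path_pmf K n) \<Longrightarrow> x \<in> set_pmf (K xs) \<Longrightarrow> 0 \<le> f xs x \<and> f xs x \<le> B"
    and c: "\<And>n xs. xs \<in> set_pmf (path_pmf K n) \<Longrightarrow> mean K f xs \<le> C * real (Suc n) powr (\<beta> - 1)"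
    and \<beta>: "\<beta> > 0"
  shows "AE \<omega> in M. \<forall>L. (\<lambda>n. path_sum (\<lambda>xs _. mean K f xs) (hist n \<omega>) / real n powr \<beta>) \<longlonglongrightarrow> L
     \<longrightarrow> (\<lambda>n. path_sum f (hist n \<omega>) / real n powr \<beta>) \<longlonglongrightarrow> L"
proof -
  let ?T = "path_sum (\<lambda>xs x. f xs x - mean K f xs)"
  have B: "B \<ge> 0"
  proof -
    obtain x where "x \<in> set_pmf (K [])" using set_pmf_not_empty[of "K []"] by blast
    then show ?thesis using f[of "[]" 0 x] by force
  qed
  \<comment> \<open>The accumulated bounds on the means, divided by n^\<beta>, converge;
    \<open>C'\<close> is a bound for them.\<close>
  have "(\<lambda>n. C * real (Suc n) powr (\<beta> - 1) * real (Suc n) powr (1 - \<beta>)) \<longlonglongrightarrow> C"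
    by (simp add: mult.assoc flip: powr_add)
  from convergent_imp_Bseq[OF convergentI[OF tendsto_sum_div_powr[OF \<beta> this]]]
  obtain C' where C': "\<And>n. \<bar>(\<Sum>k<n. C * real (Suc k) powr (\<beta> - 1)) / real n powr \<beta>\<bar> \<le> C'"
    unfolding Bseq_def real_norm_def by blast
  have C'_nonneg: "C' \<ge> 0" using C'[of 0] by simp
  \<comment> \<open>At time k^m the second moment is of order k^(-m \<beta>), which is summable for
    this m.\<close>
  obtain m :: nat where m: "real m * \<beta> > 1"
    using reals_Archimedean3[OF \<beta>] by blast
  then have m0: "m > 0" by (cases m) auto
  have moment: "(\<integral>\<^sup>+\<omega>. ennreal ((?T (hist n \<omega>) / real n powr \<beta>)\<^sup>2) \<partial>M) \<le> ennreal (B * C' * real n powr (-\<beta>))" if "n > 0" for n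
  proof -
    have "(\<integral>\<^sup>+\<omega>. ennreal ((?T (hist n \<omega>) / real n powr \<beta>)\<^sup>2) \<partial>M)
        = (\<integral>\<^sup>+xs. ennreal ((?T xs / real n powr \<beta>)\<^sup>2) \<partial>path_pmf K n)"
      by (rule nn_integral_hist)
    also have "\<dots> = ennreal (measure_pmf.expectation (path_pmf K n) (\<lambda>xs. (?T xs / real n powr \<beta>)\<^sup>2))"
      by (intro nn_integral_eq_integral integrable_measure_pmf_finite finite_path_pmf) auto
    also have "measure_pmf.expectation (path_pmf K n) (\<lambda>xs. (?T xs / real n powr \<beta>)\<^sup>2)
        = measure_pmf.expectation (path_pmf K n) (\<lambda>xs. (?T xs)\<^sup>2) / (real n powr \<beta>)\<^sup>2"
      by (simp add: power_divide)
    also have "\<dots> \<le> B * (\<Sum>k<n. C * real (Suc k) powr (\<beta> - 1)) / (real n powr \<beta>)\<^sup>2"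
      by (intro divide_right_mono path_pmf_second_moment f c B) auto
    also have "\<dots> = B * (((\<Sum>k<n. C * real (Suc k) powr (\<beta> - 1)) / real n powr \<beta>) * real n powr (-\<beta>))"
      by (simp add: power2_eq_square powr_minus_divide)
    also have "\<dots> \<le> B * (C' * real n powr (-\<beta>))"
      using B by (intro mult_left_mono mult_right_mono order_trans[OF abs_ge_self C'[of n]]) auto
    finally show ?thesis by (simp add: mult.assoc ennreal_leI)
  qed
  \<comment> \<open>The times start at 1, as \<open>moment\<close> speaks of positive n only;
    \<open>LIMSEQ_imp_Suc\<close> undoes the shift later.\<close>
  let ?s = "\<lambda>k. Suc k ^ m"
  have "summable (\<lambda>k. real (Suc k) powr (- (real m * \<beta>)))"
    using m by (subst summable_Suc_iff) (simp add: summable_real_powr_iff)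
  then have summ: "summable (\<lambda>k. B * C' * real (Suc k) powr (- (real m * \<beta>)))"
    by (rule summable_mult)
  have powr_s: "real (?s k) powr (-\<beta>) = real (Suc k) powr (- (real m * \<beta>))" for k
    by (simp add: powr_powr flip: powr_realpow)
  have meas: "(\<lambda>\<omega>. ennreal ((?T (hist (?s k) \<omega>) / real (?s k) powr \<beta>)\<^sup>2)) \<in> borel_measurable M" for k
    using measurable_compose[OF hist_measurable, of "\<lambda>xs. ennreal ((?T xs / real (?s k) powr \<beta>)\<^sup>2)" borel]
    by (simp del: power_Suc of_nat_power)
  have "(\<integral>\<^sup>+\<omega>. (\<Sum>k. ennreal ((?T (hist (?s k) \<omega>) / real (?s k) powr \<beta>)\<^sup>2)) \<partial>M)
      = (\<Sum>k. \<integral>\<^sup>+\<omega>. ennreal ((?T (hist (?s k) \<omega>) / real (?s k) powr \<beta>)\<^sup>2) \<partial>M)"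
    by (rule nn_integral_suminf) (rule meas)
  also have "\<dots> \<le> (\<Sum>k. ennreal (B * C' * real (?s k) powr (-\<beta>)))"
    by (intro suminf_le moment) auto
  also have "\<dots> = (\<Sum>k. ennreal (B * C' * real (Suc k) powr (- (real m * \<beta>))))"
    unfolding powr_s ..
  also have "\<dots> < \<infinity>"
    using summ B C'_nonneg by (subst suminf_ennreal2) auto
  finally have "AE \<omega> in M. (\<Sum>k. ennreal ((?T (hist (?s k) \<omega>) / real (?s k) powr \<beta>)\<^sup>2)) \<noteq> \<infinity>"
    by (intro nn_integral_noteq_infinite borel_measurable_suminf_order meas) (simp only: infinity_ennreal_def less_top)
  then show ?thesis using AE_hist
  proof eventually_elim
    case (elim \<omega>)
    show ?case
    proof (intro allI impI)
      fix L
      let ?A = "path_sum (\<lambda>xs _. mean K f xs)"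
      assume A: "(\<lambda>n. ?A (hist n \<omega>) / real n powr \<beta>) \<longlonglongrightarrow> L"
      have "summable (\<lambda>k. (?T (hist (?s k) \<omega>) / real (?s k) powr \<beta>)\<^sup>2)"
        using elim(1) by (intro summable_suminf_not_top) auto
      then have "(\<lambda>k. (?T (hist (?s k) \<omega>) / real (?s k) powr \<beta>)\<^sup>2) \<longlonglongrightarrow> 0"
        by (rule summable_LIMSEQ_zero)
      then have "(\<lambda>k. ?T (hist (?s k) \<omega>) / real (?s k) powr \<beta>) \<longlonglongrightarrow> 0"
        by (auto dest: tendsto_real_sqrt intro: tendsto_rabs_zero_cancel simp del: power_Suc of_nat_power)
      then have T: "(\<lambda>k. ?T (hist (k ^ m) \<omega>) / real (k ^ m) powr \<beta>) \<longlonglongrightarrow> 0"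
        by (rule LIMSEQ_imp_Suc)
      have "filterlim (\<lambda>k. k ^ m) at_top sequentially"
        using m0 by real_asymp
      from tendsto_add[OF T filterlim_compose[OF A this]]
      have Y: "(\<lambda>k. path_sum f (hist (k ^ m) \<omega>) / real (k ^ m) powr \<beta>) \<longlonglongrightarrow> L"
        by (simp add: path_sum_diff diff_divide_distrib)
      have f0: "\<And>n xs x. xs \<in> set_pmf (path_pmf K n) \<Longrightarrow> x \<in> set_pmf (K xs) \<Longrightarrow> 0 \<le> f xs x"
        using f by blast
      show "(\<lambda>n. path_sum f (hist n \<omega>) / real n powr \<beta>) \<longlonglongrightarrow> L"
        by (rule tendsto_div_powr_of_power_subseq[OF \<beta> m0 _ _ Y])
           (use elim(2) f0 in \<open>auto intro!: path_sum_mono\<close>)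
    qed
  qed
qed

end

section \<open>Clique weights and degrees along a history\<close>

lemma card_subsets_containing:
  assumes "finite A" "v \<in> A" "m \<ge> 1"
  shows "card {C. C \<subseteq> A \<and> card C = m \<and> v \<in> C} = (card A - 1) choose (m - 1)"
proof -
  have "bij_betw (insert v) {C. C \<subseteq> A - {v} \<and> card C = m - 1} {C. C \<subseteq> A \<and> card C = m \<and> v \<in> C}"
  proof (rule bij_betw_byWitness[where f' = "\<lambda>C. C - {v}"])
    show "insert v ` {C. C \<subseteq> A - {v} \<and> card C = m - 1} \<subseteq> {C. C \<subseteq> A \<and> card C = m \<and> v \<in> C}"
    proof (clarify, intro conjI)
      fix C assume C: "C \<subseteq> A - {v}" "card C = m - 1"
      then have "finite C" "v \<notin> C" using assms(1) by (auto intro: finite_subset)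
      then show "card (insert v C) = m" using C(2) assms(3) by simp
    qed (use assms in auto)
  qed (use assms in auto)
  from bij_betw_same_card[OF this] show ?thesis
    using n_subsets[of "A - {v}" "m - 1"] assms by simp
qed

lemma sum_sum_list_swap:
  "(\<Sum>x\<in>X. \<Sum>y\<leftarrow>L. f x y) = (\<Sum>y\<leftarrow>L. \<Sum>x\<in>X. (f x y :: nat))"
  by (induction L) (auto simp: sum.distrib)

lemma expectation_weighted_pmf:
  assumes "finite A" and "\<exists>y\<in>A. w y > 0"
  shows "measure_pmf.expectation (weighted_pmf A w) g
    = (\<Sum>x\<in>A. real (w x) * g x) / (\<Sum>x\<in>A. real (w x))"
proof -
  have "measure_pmf.expectation (weighted_pmf A w) g = (\<Sum>x\<in>A. g x * pmf (weighted_pmf A w) x)"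
    using pmf_weighted_pmf[OF assms] by (intro integral_measure_pmf_real assms) (auto simp: set_pmf_iff split: if_splits)
  also have "\<dots> = (\<Sum>x\<in>A. real (w x) * g x / (\<Sum>x\<in>A. real (w x)))"
    using pmf_weighted_pmf[OF assms] by (intro sum.cong) auto
  finally show ?thesis by (simp add: sum_divide_distrib)
qed

lemma expectation_bind_bernoulli:
  fixes g :: "'b \<Rightarrow> real"
  assumes p: "0 \<le> p" "p \<le> 1" and F: "\<And>b. finite (set_pmf (F b))"
  shows "measure_pmf.expectation (bind_pmf (bernoulli_pmf p) F) g
    = p * measure_pmf.expectation (F True) g + (1 - p) * measure_pmf.expectation (F False) g"
  using p by (subst pmf_expectation_bind[of UNIV]) (auto simp: F UNIV_bool)

lemma set_weighted_pmf_subset: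
  assumes "finite A" and "\<exists>y\<in>A. w y > 0"
  shows "set_pmf (weighted_pmf A w) \<subseteq> A"
  using pmf_weighted_pmf[OF assms] by (auto simp: set_pmf_iff split: if_splits)

definition hist_graph :: "nat \<Rightarrow> int set list \<Rightarrow> wgraph" where
  "hist_graph N hs = foldr interact hs (initial_graph N)"

lemma hist_graph_simps [simp]:
  "hist_graph N [] = initial_graph N"
  "hist_graph N (A # hs) = interact A (hist_graph N hs)"
  by (simp_all add: hist_graph_def)

lemma graph_after_eq_hist_graph:
  "graph_after N h n = hist_graph N (map h (rev [1..<Suc n]))"
  by (induction n) auto

text \<open>The initial graph counts as an interaction, so vertices, edges and weights are all read off
  the list of drawn cliques.\<close>

definition cliques_drawn :: "nat \<Rightarrow> int set list \<Rightarrow> int set list" where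
  "cliques_drawn N hs = hs @ [{1 - int N..0}]"

lemma vertices_hist_graph: "vertices (hist_graph N hs) = \<Union>(set (cliques_drawn N hs))"
  by (induction hs) (auto simp: cliques_drawn_def initial_graph_def interact_def Let_def)

lemma edges_hist_graph: "edges (hist_graph N hs) = \<Union>(complete_edges ` set (cliques_drawn N hs))"
  by (induction hs) (auto simp: cliques_drawn_def initial_graph_def interact_def Let_def)

lemma weight_hist_graph:
  "C \<noteq> {} \<Longrightarrow> weight (hist_graph N hs) C = (\<Sum>A\<leftarrow>cliques_drawn N hs. of_bool (C \<subseteq> A))"
  by (induction hs) (auto simp: cliques_drawn_def initial_graph_def interact_def Let_def)

text \<open>The subtraction on natural numbers loses nothing: an interaction only adds edges, see
  \<open>degree_interact\<close>.\<close>

definition degree_gain :: "wgraph \<Rightarrow> int \<Rightarrow> int set \<Rightarrow> nat" where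
  "degree_gain G v A = vertex_degree (interact A G) v - vertex_degree G v"

text \<open>One history is fixed, so that conditional expectations given the past become plain
  expectations under the law of a single step.\<close>

locale interaction_history =
  fixes N :: nat and p q r :: real and hs :: "int set list"
  assumes N3: "N \<ge> 3"
    and p_range: "0 < p" "p \<le> 1" and q_range: "0 \<le> q" "q \<le> 1" and r_range: "0 \<le> r" "r \<le> 1"
    and history_sets: "\<And>A. A \<in> set hs \<Longrightarrow> finite A \<and> card A = N"
begin

abbreviation "G \<equiv> hist_graph N hs"
abbreviation "V \<equiv> vertices G"
abbreviation "L \<equiv> cliques_drawn N hs"

lemma L: "A \<in> set L \<Longrightarrow> finite A \<and> card A = N"
  using history_sets by (auto simp: cliques_drawn_def)

lemma length_L: "length L = Suc (length hs)"
  by (simp add: cliques_drawn_def)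

lemma finite_V: "finite V"
  using L by (auto simp: vertices_hist_graph)

lemma card_V_ge: "card V \<ge> N"
proof -
  have "{1 - int N..0} \<subseteq> V" by (auto simp: vertices_hist_graph cliques_drawn_def)
  from card_mono[OF finite_V this] show ?thesis by simp
qed

lemma new_vertex_notin: "new_vertex G \<notin> V"
  using finite_V Max_ge[OF finite_V, of "new_vertex G"] by (auto simp: new_vertex_def)

lemma edges_subset: "e \<in> edges G \<Longrightarrow> e \<subseteq> V"
  by (auto simp: edges_hist_graph vertices_hist_graph complete_edges_def)

lemma finite_edges: "finite (edges G)"
  using finite_subset[of "edges G" "Pow V"] edges_subset finite_V by auto

lemma finite_vertex_subsets: "finite (vertex_subsets m G)"
  using finite_V by (auto simp: vertex_subsets_def)

lemma finite_cliques: "finite (cliques m G)"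
  using finite_vertex_subsets by (auto simp: cliques_def)

lemma card_vertex_subsets: "card (vertex_subsets m G) = card V choose m"
  using n_subsets[OF finite_V] by (simp add: vertex_subsets_def)

section \<open>Total clique weights by double counting\<close>

lemma subset_drawn_clique:
  assumes "A \<in> set L" "C \<subseteq> A" "card C = m"
  shows "C \<in> cliques m G"
proof -
  have "C \<subseteq> V" using assms(1,2) unfolding vertices_hist_graph by blast
  moreover have "complete_edges C \<subseteq> complete_edges A" using assms(2) unfolding complete_edges_def by blast
  then have "complete_edges C \<subseteq> edges G" using assms(1) unfolding edges_hist_graph by blast
  ultimately show ?thesis using assms(3) by (simp add: cliques_def vertex_subsets_def)
qed

text \<open>The weight of C counts the drawn sets containing C. Exchanging the sums counts, for each
  drawn set, its m-subsets with property Q, all of which are cliques. \<open>m \<ge> 1\<close>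
  excludes the empty set, whose weight is 0.\<close>

lemma sum_weight_cliques:
  assumes "m \<ge> 1"
  shows "(\<Sum>C\<in>cliques m G. weight G C * of_bool (Q C)) = (\<Sum>A\<leftarrow>L. card {C. C \<subseteq> A \<and> card C = m \<and> Q C})"
proof -
  have "(\<Sum>C\<in>cliques m G. weight G C * of_bool (Q C))
      = (\<Sum>C\<in>cliques m G. \<Sum>A\<leftarrow>L. of_bool (C \<subseteq> A \<and> Q C))"
  proof (intro sum.cong refl)
    fix C assume "C \<in> cliques m G"
    then have "C \<noteq> {}" using assms by (auto simp: cliques_def vertex_subsets_def)
    then show "weight G C * of_bool (Q C) = (\<Sum>A\<leftarrow>L. of_bool (C \<subseteq> A \<and> Q C))"
      by (cases "Q C") (auto simp: weight_hist_graph)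
  qed
  also have "\<dots> = (\<Sum>A\<leftarrow>L. \<Sum>C\<in>cliques m G. of_bool (C \<subseteq> A \<and> Q C))"
    by (rule sum_sum_list_swap)
  also have "\<dots> = (\<Sum>A\<leftarrow>L. card {C. C \<subseteq> A \<and> card C = m \<and> Q C})"
  proof (intro arg_cong[of _ _ sum_list] map_cong refl)
    fix A assume A: "A \<in> set L"
    have "(\<Sum>C\<in>cliques m G. of_bool (C \<subseteq> A \<and> Q C)) = card (cliques m G \<inter> {C. C \<subseteq> A \<and> Q C})"
      using finite_cliques by (simp add: Int_def)
    also have "cliques m G \<inter> {C. C \<subseteq> A \<and> Q C} = {C. C \<subseteq> A \<and> card C = m \<and> Q C}"
      using subset_drawn_clique[OF A] by (auto simp: cliques_def vertex_subsets_def)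
    finally show "(\<Sum>C\<in>cliques m G. of_bool (C \<subseteq> A \<and> Q C)) = card {C. C \<subseteq> A \<and> card C = m \<and> Q C}" .
  qed
  finally show ?thesis .
qed

lemma total_weight_cliques:
  assumes "m \<ge> 1"
  shows "(\<Sum>C\<in>cliques m G. weight G C) = (N choose m) * Suc (length hs)"
proof -
  have "(\<Sum>C\<in>cliques m G. weight G C) = (\<Sum>A\<leftarrow>L. card {C. C \<subseteq> A \<and> card C = m})"
    using sum_weight_cliques[OF assms, of "\<lambda>_. True"] by simp
  also have "\<dots> = (\<Sum>A\<leftarrow>L. N choose m)"
    using L n_subsets by (intro arg_cong[of _ _ sum_list] map_cong refl) auto
  finally show ?thesis by (simp add: sum_list_triv length_L mult.commute)
qed

text \<open>Each drawn set through v contributes its m-subsets through v. Divided by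
  \<open>total_weight_cliques\<close> this yields, for m up to N, the probability m W / (N (n + 1))
  that an m-clique chosen by weight contains v, where W is the weight of v and n the length of the
  history.\<close>

lemma weight_cliques_containing:
  assumes "m \<ge> 1"
  shows "(\<Sum>C\<in>cliques m G. weight G C * of_bool (v \<in> C)) = ((N - 1) choose (m - 1)) * vertex_weight G v"
proof -
  have "card {C. C \<subseteq> A \<and> card C = m \<and> v \<in> C} = ((N - 1) choose (m - 1)) * of_bool (v \<in> A)" if "A \<in> set L" for A
  proof (cases "v \<in> A")
    case True
    then show ?thesis using L[OF that] card_subsets_containing[of A v m] assms by simp
  next
    case False
    then have "{C. C \<subseteq> A \<and> card C = m \<and> v \<in> C} = {}" by auto
    then show ?thesis using False by (simp only: card.empty of_bool_eq mult_0_right)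
  qed
  then have eq: "(\<Sum>A\<leftarrow>L. card {C. C \<subseteq> A \<and> card C = m \<and> v \<in> C})
      = (\<Sum>A\<leftarrow>L. ((N - 1) choose (m - 1)) * of_bool (v \<in> A))"
    by (intro arg_cong[of _ _ sum_list] map_cong refl)
  show ?thesis
    unfolding sum_weight_cliques[OF assms] eq sum_list_const_mult vertex_weight_def
    by (simp add: weight_hist_graph)
qed

text \<open>Ensures that the normalising sum in \<open>weighted_pmf\<close> does not vanish.\<close>

lemma positive_weight_clique:
  assumes "1 \<le> m" "m \<le> N"
  shows "\<exists>C\<in>cliques m G. weight G C > 0"
proof (rule ccontr)
  assume "\<not> ?thesis"
  then have "(\<Sum>C\<in>cliques m G. weight G C) = 0" by simp
  then show False using total_weight_cliques[of m] assms by simp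
qed

lemma vertex_subsets_nonempty: "m \<le> N \<Longrightarrow> vertex_subsets m G \<noteq> {}"
  using card_vertex_subsets[of m] card_V_ge by (auto simp: not_less dest!: sym[of 0])

section \<open>The law of one step\<close>

abbreviation "pref m \<equiv> weighted_pmf (cliques m G) (weight G)"
abbreviation "unif m \<equiv> pmf_of_set (vertex_subsets m G)"

lemma set_pref: "1 \<le> m \<Longrightarrow> m \<le> N \<Longrightarrow> set_pmf (pref m) \<subseteq> cliques m G"
  by (rule set_weighted_pmf_subset[OF finite_cliques positive_weight_clique])

lemma set_unif: "m \<le> N \<Longrightarrow> set_pmf (unif m) = vertex_subsets m G"
  by (rule set_pmf_of_set[OF vertex_subsets_nonempty finite_vertex_subsets])

lemma finite_set_pref: "1 \<le> m \<Longrightarrow> m \<le> N \<Longrightarrow> finite (set_pmf (pref m))"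
  by (rule finite_subset[OF set_pref finite_cliques])

lemma finite_set_unif: "m \<le> N \<Longrightarrow> finite (set_pmf (unif m))"
  by (simp add: set_unif finite_vertex_subsets)

abbreviation "step \<equiv> interacting_pmf N p q r G"

lemma finite_set_step: "finite (set_pmf step)"
  using N3 by (auto simp: interacting_pmf_def finite_set_pref finite_set_unif)

lemma vertex_subsetsD:
  assumes "C \<in> vertex_subsets m G"
  shows "finite C" "card C = m" "C \<subseteq> V" "new_vertex G \<notin> C"
  using assms new_vertex_notin finite_subset[OF _ finite_V, of C] by (auto simp: vertex_subsets_def)

lemma set_step:
  assumes "A \<in> set_pmf step"
  shows "finite A" "card A = N" "A \<subseteq> insert (new_vertex G) V"
proof -
  have cliques: "cliques m G \<subseteq> vertex_subsets m G" for m by (auto simp: cliques_def)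
  have S: "set_pmf (pref m) \<subseteq> vertex_subsets m G" "set_pmf (unif m) \<subseteq> vertex_subsets m G"
    if "1 \<le> m" "m \<le> N" for m
    using set_pref[OF that] cliques[of m] set_unif[OF that(2)] by simp_all
  have "(\<exists>C \<in> vertex_subsets (N - 1) G. A = insert (new_vertex G) C) \<or> A \<in> vertex_subsets N G"
  proof -
    let ?i = "insert (new_vertex G)"
    have "A \<in> ?i ` set_pmf (pref (N - 1)) \<union> ?i ` set_pmf (unif (N - 1)) \<union> set_pmf (pref N) \<union> set_pmf (unif N)"
      using assms unfolding interacting_pmf_def set_bind_pmf by (fastforce split: if_splits)
    moreover have "1 \<le> N - 1" "N - 1 \<le> N" "1 \<le> N" using N3 by auto
    ultimately show ?thesis
      using S[of "N - 1"] S[of N] by blast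
  qed
  then show "finite A" "card A = N" "A \<subseteq> insert (new_vertex G) V"
    using N3 by (auto simp: vertex_subsetsD dest: subsetD[OF vertex_subsetsD(3)])
qed

lemma expectation_step:
  fixes g :: "int set \<Rightarrow> real"
  shows "measure_pmf.expectation step g =
     p * (r * measure_pmf.expectation (pref (N - 1)) (\<lambda>C. g (insert (new_vertex G) C))
          + (1 - r) * measure_pmf.expectation (unif (N - 1)) (\<lambda>C. g (insert (new_vertex G) C)))
     + (1 - p) * (q * measure_pmf.expectation (pref N) g + (1 - q) * measure_pmf.expectation (unif N) g)"
proof -
  have fin: "finite (set_pmf (if b then pref m else unif m))" if "1 \<le> m" "m \<le> N" for b m
    using finite_set_pref[OF that] finite_set_unif[OF that(2)] by simp
  have N: "1 \<le> N - 1" "N - 1 \<le> N" "1 \<le> N" "N \<le> N" using N3 by auto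
  note fins = fin[OF N(1,2)] fin[OF N(3,4)]
  show ?thesis
    unfolding interacting_pmf_def
    apply (subst expectation_bind_bernoulli)
    subgoal using p_range by simp
    subgoal using p_range by simp
    subgoal using fins by (simp split: if_split)
    using q_range r_range fins by (simp add: expectation_bind_bernoulli del: One_nat_def)
qed

text \<open>The fresh label lies outside V, so its membership in the interacting set tells exactly
  whether a vertex is added.\<close>

lemma prob_new_vertex: "measure_pmf.expectation step (\<lambda>A. of_bool (new_vertex G \<in> A)) = p"
proof -
  have "measure_pmf.expectation P (\<lambda>A. of_bool (new_vertex G \<in> A)) = (0::real)"
    if "set_pmf P \<subseteq> vertex_subsets N G" for P
  proof -
    have "measure_pmf.expectation P (\<lambda>A. of_bool (new_vertex G \<in> A)) = measure_pmf.expectation P (\<lambda>_. 0::real)"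
      using that new_vertex_notin by (intro integral_cong_AE) (auto simp: AE_measure_pmf_iff vertex_subsets_def)
    then show ?thesis by simp
  qed
  from this[of "pref N"] this[of "unif N"] show ?thesis
    using set_pref[of N] set_unif[of N] N3
    by (subst expectation_step) (auto simp: cliques_def algebra_simps)
qed

section \<open>Degree gains in one step\<close>

lemma degree_interact:
  "finite A \<Longrightarrow> vertex_degree (interact A G) v = vertex_degree G v + degree_gain G v A"
  unfolding degree_gain_def vertex_degree_def interact_def
  using finite_edges by (intro le_add_diff_inverse[symmetric] card_mono) (auto simp: complete_edges_def)

lemma degree_gain_le:
  assumes "finite A"
  shows "degree_gain G v A \<le> card A * of_bool (v \<in> A)"
proof -
  have "{e \<in> edges (interact A G). v \<in> e} = {e \<in> edges G. v \<in> e} \<union> {e \<in> complete_edges A. v \<in> e}"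
    by (auto simp: interact_def)
  then have "degree_gain G v A \<le> card {e \<in> complete_edges A. v \<in> e}"
    unfolding degree_gain_def vertex_degree_def
    using card_Un_le[of "{e \<in> edges G. v \<in> e}" "{e \<in> complete_edges A. v \<in> e}"] by simp
  also have "{e \<in> complete_edges A. v \<in> e} \<subseteq> (if v \<in> A then (\<lambda>u. {u, v}) ` A else {})"
    by (auto simp: complete_edges_def card_2_iff)
  then have "card {e \<in> complete_edges A. v \<in> e} \<le> card (if v \<in> A then (\<lambda>u. {u, v}) ` A else {})"
    using assms by (intro card_mono) auto
  also have "\<dots> \<le> card A * of_bool (v \<in> A)"
    using assms by (auto intro: card_image_le)
  finally show ?thesis .
qed

lemma degree_gain_clique: "complete_edges C \<subseteq> edges G \<Longrightarrow> degree_gain G v C = 0"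
  by (auto simp: degree_gain_def vertex_degree_def interact_def Un_absorb2)

text \<open>The clique C has all its edges already, so the only possibly new edge at v is the one to
  the new vertex, and that edge is absent before because its endpoint is not in V.\<close>

lemma degree_gain_new_vertex_clique:
  assumes C: "complete_edges C \<subseteq> edges G" "C \<subseteq> V" and v: "v \<in> V"
  shows "degree_gain G v (insert (new_vertex G) C) = of_bool (v \<in> C)"
proof -
  let ?x = "new_vertex G"
  have vx: "v \<noteq> ?x" using v new_vertex_notin by auto
  have *: "{e \<in> edges (interact (insert ?x C) G). v \<in> e} = {e \<in> edges G. v \<in> e} \<union> (if v \<in> C then {{v, ?x}} else {})"
  proof -
    have "e \<in> edges G \<or> v \<in> C \<and> e = {v, ?x}" if e: "e \<in> complete_edges (insert ?x C)" "v \<in> e" for e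
    proof (cases "?x \<in> e")
      case True
      then show ?thesis using e vx by (auto simp: complete_edges_def card_2_iff)
    next
      case False
      then have "e \<in> complete_edges C" using e by (auto simp: complete_edges_def)
      then show ?thesis using C by auto
    qed
    then show ?thesis using vx by (auto simp: interact_def complete_edges_def)
  qed
  have "{v, ?x} \<notin> edges G" using edges_subset[of "{v, ?x}"] new_vertex_notin by auto
  then show ?thesis
    unfolding degree_gain_def vertex_degree_def * using finite_edges by auto
qed

lemma prob_unif_containing:
  assumes "v \<in> V" "1 \<le> m" "m \<le> N"
  shows "measure_pmf.expectation (unif m) (\<lambda>C. of_bool (v \<in> C)) = real m / real (card V)"
proof -
  have "measure_pmf.expectation (unif m) (\<lambda>C. of_bool (v \<in> C))
      = (\<Sum>C\<in>vertex_subsets m G. of_bool (v \<in> C)) / real (card V choose m)"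
    using assms by (subst integral_pmf_of_set) (auto simp: vertex_subsets_nonempty finite_vertex_subsets card_vertex_subsets)
  also have "(\<Sum>C\<in>vertex_subsets m G. of_bool (v \<in> C) :: real) = real (card {C \<in> vertex_subsets m G. v \<in> C})"
    using finite_vertex_subsets by (simp add: Int_def)
  also have "{C \<in> vertex_subsets m G. v \<in> C} = {C. C \<subseteq> V \<and> card C = m \<and> v \<in> C}"
    by (auto simp: vertex_subsets_def)
  also have "card \<dots> = (card V - 1) choose (m - 1)"
    by (rule card_subsets_containing) (use assms finite_V in auto)
  also have "real \<dots> / real (card V choose m) = real m / real (card V)"
  proof -
    have "m * (card V choose m) = card V * ((card V - 1) choose (m - 1))"
      using assms by (intro times_binomial_minus1_eq) auto
    then have "real m * real (card V choose m) = real (card V) * real ((card V - 1) choose (m - 1))"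
      by (metis of_nat_mult)
    moreover have "card V choose m > 0" "card V > 0"
      using card_V_ge assms N3 by auto
    ultimately show ?thesis by (simp add: field_simps)
  qed
  finally show ?thesis .
qed

text \<open>Of the four kinds of step, the preferential one with a new vertex contributes exactly
  \<mu> and the preferential one without contributes 0. Each uniform choice contributes at most N
  times the probability of hitting v, hence at most N^2 / |V|.\<close>

lemma mean_degree_gain:
  assumes v: "v \<in> V"
  defines "\<mu> \<equiv> alpha2 N p r * real (vertex_weight G v) / real (Suc (length hs))"
  shows "\<mu> \<le> measure_pmf.expectation step (\<lambda>A. real (degree_gain G v A))"
    and "measure_pmf.expectation step (\<lambda>A. real (degree_gain G v A)) \<le> \<mu> + (real N)\<^sup>2 / real (card V)"
proof -
  let ?g = "\<lambda>A. real (degree_gain G v A)"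
  let ?x = "new_vertex G"
  have vx: "v \<noteq> ?x" using v new_vertex_notin by auto
  have pref_old: "measure_pmf.expectation (pref N) ?g = 0"
  proof -
    have "measure_pmf.expectation (pref N) ?g = measure_pmf.expectation (pref N) (\<lambda>_. 0)"
      using set_pref[of N] N3 degree_gain_clique
      by (intro integral_cong_AE) (auto simp: AE_measure_pmf_iff cliques_def)
    then show ?thesis by simp
  qed
  have "degree_gain G v (insert ?x C) = of_bool (v \<in> C)" if "C \<in> set_pmf (pref (N - 1))" for C
  proof -
    have "C \<in> cliques (N - 1) G" 
      by (rule subsetD[OF set_pref that]) (use N3 in auto)
    then show ?thesis
      by (intro degree_gain_new_vertex_clique v) (auto simp: cliques_def vertex_subsets_def)
  qed
  then have "measure_pmf.expectation (pref (N - 1)) (\<lambda>C. ?g (insert ?x C))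
      = measure_pmf.expectation (pref (N - 1)) (\<lambda>C. real (of_bool (v \<in> C)))"
    by (intro integral_cong_AE AE_pmfI) auto
  also have "\<dots> = (\<Sum>C\<in>cliques (N - 1) G. real (weight G C) * real (of_bool (v \<in> C))) / (\<Sum>C\<in>cliques (N - 1) G. real (weight G C))"
    using N3 by (intro expectation_weighted_pmf finite_cliques positive_weight_clique) auto
  also have "(\<Sum>C\<in>cliques (N - 1) G. real (weight G C) * real (of_bool (v \<in> C)))
      = real (\<Sum>C\<in>cliques (N - 1) G. weight G C * of_bool (v \<in> C))"
    by simp
  also have "(\<Sum>C\<in>cliques (N - 1) G. weight G C * of_bool (v \<in> C)) = ((N - 1) choose (N - 2)) * vertex_weight G v"
    using N3 by (subst weight_cliques_containing) (auto simp: numeral_2_eq_2)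
  \<comment> \<open>Together with the N in the total weight below, this produces the factor (N - 1)
    / N of \<open>alpha2\<close>.\<close>
  also have "(N - 1) choose (N - 2) = N - 1"
    using N3 binomial_symmetric[of "N - 2" "N - 1"] by simp
  also have "(\<Sum>C\<in>cliques (N - 1) G. real (weight G C)) = real (\<Sum>C\<in>cliques (N - 1) G. weight G C)"
    by simp
  also have "(\<Sum>C\<in>cliques (N - 1) G. weight G C) = N * Suc (length hs)"
    using N3 binomial_symmetric[of "N - 1" N] by (subst total_weight_cliques) auto
  finally have pref_new: "p * r * measure_pmf.expectation (pref (N - 1)) (\<lambda>C. ?g (insert ?x C)) = \<mu>"
    using N3 by (simp add: \<mu>_def alpha2_def field_simps of_nat_diff)
  have unif: "0 \<le> measure_pmf.expectation (unif m) g \<and> measure_pmf.expectation (unif m) g \<le> (real N)\<^sup>2 / real (card V)"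
    if m: "1 \<le> m" "m \<le> N" and g: "\<And>C. C \<in> vertex_subsets m G \<Longrightarrow> 0 \<le> g C \<and> g C \<le> real N * of_bool (v \<in> C)" for m g
  proof
    show "0 \<le> measure_pmf.expectation (unif m) g"
      using g m set_unif by (intro integral_nonneg_AE) (auto simp: AE_measure_pmf_iff)
    have "measure_pmf.expectation (unif m) g \<le> measure_pmf.expectation (unif m) (\<lambda>C. real N * of_bool (v \<in> C))"
      using g m set_unif by (intro integral_mono_AE integrable_measure_pmf_finite finite_set_unif) (auto simp: AE_measure_pmf_iff)
    also have "\<dots> = real N * (real m / real (card V))"
      using prob_unif_containing[OF v m] by simp
    also have "\<dots> \<le> (real N)\<^sup>2 / real (card V)"
      using m by (simp add: power2_eq_square mult_left_mono divide_right_mono)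
    finally show "measure_pmf.expectation (unif m) g \<le> (real N)\<^sup>2 / real (card V)" .
  qed
  have "?g (insert ?x C) \<le> real N * of_bool (v \<in> C)" if "C \<in> vertex_subsets (N - 1) G" for C
    using degree_gain_le[of "insert ?x C" v] vertex_subsetsD[OF that] vx N3 by (cases "v \<in> C") auto
  from unif[of "N - 1", OF _ _ conjI[OF _ this]]
  have u1: "0 \<le> measure_pmf.expectation (unif (N - 1)) (\<lambda>C. ?g (insert ?x C))"
     "measure_pmf.expectation (unif (N - 1)) (\<lambda>C. ?g (insert ?x C)) \<le> (real N)\<^sup>2 / real (card V)" (is "?u1 \<le> ?R")
    using N3 by auto
  have "?g C \<le> real N * of_bool (v \<in> C)" if "C \<in> vertex_subsets N G" for C
    using degree_gain_le[of C v] vertex_subsetsD[OF that] by (cases "v \<in> C") auto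
  from unif[of N, OF _ _ conjI[OF _ this]]
  have u2: "0 \<le> measure_pmf.expectation (unif N) ?g"
     "measure_pmf.expectation (unif N) ?g \<le> (real N)\<^sup>2 / real (card V)" (is "?u2 \<le> _")
    using N3 by auto
  have eq: "measure_pmf.expectation step ?g = \<mu> + (p * (1 - r) * ?u1 + (1 - p) * (1 - q) * ?u2)"
    unfolding pref_new[symmetric] by (subst expectation_step) (simp add: pref_old algebra_simps)
  have "0 \<le> p * (1 - r) * ?u1 + (1 - p) * (1 - q) * ?u2"
    using p_range q_range r_range u1 u2 by simp
  then show "\<mu> \<le> measure_pmf.expectation step ?g" unfolding eq by simp
  \<comment> \<open>Bounding 1 - r and 1 - q by 1 leaves a convex combination with weights p and 1 -
    p.\<close>
  have "p * (1 - r) * ?u1 + (1 - p) * (1 - q) * ?u2 \<le> p * 1 * ?R + (1 - p) * 1 * ?R"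
    using p_range q_range r_range u1 u2 by (intro add_mono mult_mono) auto
  also have "\<dots> = ?R" by (simp only: mult_1_right flip: distrib_right) simp
  finally show "measure_pmf.expectation step ?g \<le> \<mu> + ?R" unfolding eq by simp
qed

end

section \<open>The interactions model as a kernel-driven process\<close>

text \<open>Bridges lists and the functions \<open>h\<close> in \<open>S_law\<close>: step i sits at
  position \<open>length xs - i\<close>, since the latest entry comes first.\<close>

lemma map_eq_history:
  "\<exists>h. xs = map h (rev [1..<Suc (length xs)])"
  by (rule exI[of _ "\<lambda>i. xs ! (length xs - i)"], rule nth_equalityI)
     (auto simp: rev_nth simp del: upt_Suc)

lemma pmf_map_Cons: "pmf (map_pmf (\<lambda>x. x # zs) Q) (A # ys) = pmf Q A * indicator {ys} zs"
proof (cases "zs = ys")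
  case True
  then show ?thesis using pmf_map_inj'[of "\<lambda>x. x # zs" Q A] by (simp add: inj_def)
next
  case False
  then have "A # ys \<notin> set_pmf (map_pmf (\<lambda>x. x # zs) Q)" by auto
  then have "pmf (map_pmf (\<lambda>x. x # zs) Q) (A # ys) = 0" by (simp only: set_pmf_iff not_not)
  then show ?thesis using False by simp
qed

text \<open>Only the prefix \<open>ys\<close> can be extended to \<open>A # ys\<close>, so the
  mixture collapses to one product, the same shape as in \<open>S_law\<close>.\<close>

lemma pmf_path_pmf_Cons: "pmf (path_pmf K (Suc n)) (A # ys) = pmf (path_pmf K n) ys * pmf (K ys) A"
proof -
  have "pmf (path_pmf K (Suc n)) (A # ys)
      = measure_pmf.expectation (path_pmf K n) (\<lambda>zs. pmf (K zs) A * indicator {ys} zs)"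
    by (simp add: pmf_bind pmf_map_Cons)
  also have "\<dots> = measure_pmf.expectation (path_pmf K n) (\<lambda>zs. pmf (K ys) A * indicator {ys} zs)"
    by (intro Bochner_Integration.integral_cong refl) (auto split: split_indicator)
  also have "\<dots> = pmf (path_pmf K n) ys * pmf (K ys) A"
    by (simp add: measure_pmf_single)
  finally show ?thesis .
qed

context N_interactions_model
begin

abbreviation kernel :: "int set list \<Rightarrow> int set pmf" where
  "kernel hs \<equiv> interacting_pmf N p q r (hist_graph N hs)"

definition hist :: "nat \<Rightarrow> 'a \<Rightarrow> int set list" where
  "hist n \<omega> = map (\<lambda>i. S i \<omega>) (rev [1..<Suc n])"

lemma hist_0 [simp]: "hist 0 \<omega> = []"
  by (simp add: hist_def)

lemma hist_Suc: "hist (Suc n) \<omega> = S (Suc n) \<omega> # hist n \<omega>"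
  by (simp add: hist_def)

lemma graph_after_S: "graph_after N (\<lambda>i. S i \<omega>) n = hist_graph N (hist n \<omega>)"
  by (simp add: graph_after_eq_hist_graph hist_def)

text \<open>By \<open>set_step\<close> the assumptions of the locale persist along every history of
  positive probability.\<close>

lemma interaction_history:
  "hs \<in> set_pmf (path_pmf kernel n) \<Longrightarrow> interaction_history N p q r hs"
proof (induction n arbitrary: hs)
  case 0
  then show ?case using N_ge_3 p_range q_range r_range by unfold_locales auto
next
  case (Suc n)
  then obtain A xs where hs: "hs = A # xs" and xs: "xs \<in> set_pmf (path_pmf kernel n)"
    and A: "A \<in> set_pmf (kernel xs)" by auto
  interpret interaction_history N p q r xs by (rule Suc.IH[OF xs])
  show ?case unfolding hs using set_step[OF A] N_ge_3 p_range q_range r_range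
    by unfold_locales (auto simp: history_sets)
qed

abbreviation "N_sets \<equiv> {A :: int set. finite A \<and> card A = N}"

lemma countable_N_sets: "countable N_sets"
  by (rule countable_subset[OF _ countable_Collect_finite]) auto

text \<open>The target is the countable set of lists of N-sets, not all lists, so that measurability
  can be checked on singletons; there the event is an intersection of one event for the last step
  and one for the earlier history.\<close>

lemma hist_measurable': "hist n \<in> M \<rightarrow>\<^sub>M count_space (lists N_sets)"
proof (induction n)
  case 0
  then show ?case by simp
next
  case (Suc n)
  have S: "S (Suc n) \<in> M \<rightarrow>\<^sub>M count_space N_sets" by (rule S_measurable) simp
  show ?case
  proof (subst measurable_count_space_eq_countable, intro countable_lists countable_N_sets, intro conjI funcsetI ballI)
    fix \<omega> assume "\<omega> \<in> space M"
    then show "hist (Suc n) \<omega> \<in> lists N_sets"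
      using measurable_space[OF S, of \<omega>] measurable_space[OF Suc, of \<omega>] by (simp add: hist_Suc)
  next
    fix ys assume ys: "ys \<in> lists N_sets"
    show "hist (Suc n) -` {ys} \<inter> space M \<in> sets M"
    proof (cases ys)
      case Nil
      then have "hist (Suc n) -` {ys} = {}" by (auto simp: hist_Suc)
      then show ?thesis by simp
    next
      case (Cons A zs)
      then have "hist (Suc n) -` {ys} \<inter> space M = (S (Suc n) -` {A} \<inter> space M) \<inter> (hist n -` {zs} \<inter> space M)"
        by (auto simp: hist_Suc)
      also have "\<dots> \<in> sets M"
        using ys Cons by (intro sets.Int measurable_sets[OF S] measurable_sets[OF Suc]) auto
      finally show ?thesis .
    qed
  qed
qed

lemma prob_hist: "prob {\<omega> \<in> space M. hist n \<omega> = hs} = pmf (path_pmf kernel n) hs"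
proof (induction n arbitrary: hs)
  case 0
  show ?case by (cases "hs = []") (auto simp: prob_space)
next
  case (Suc n)
  show ?case
  \<comment> \<open>A list of the wrong length has mass 0 on both sides; for the others
    \<open>S_law\<close> supplies the induction step.\<close>
  proof (cases "length hs = Suc n")
    case False
    then have "hs \<notin> set_pmf (path_pmf kernel (Suc n))" using length_path_pmf by blast
    then have "pmf (path_pmf kernel (Suc n)) hs = 0" by (simp only: set_pmf_iff not_not)
    moreover have "{\<omega> \<in> space M. hist (Suc n) \<omega> = hs} = {}"
      using False by (auto simp: hist_def)
    ultimately show ?thesis by (simp only: measure_empty)
  next
    case True
    then obtain A ys where hs: "hs = A # ys" and len: "length ys = n" by (cases hs) auto
    obtain h where h: "ys = map h (rev [1..<Suc n])" using map_eq_history[of ys] len by auto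
    have eq: "hist n \<omega> = ys \<longleftrightarrow> (\<forall>i\<in>{1..n}. S i \<omega> = h i)" for \<omega>
      unfolding hist_def h map_eq_conv by auto
    have G: "graph_after N h n = hist_graph N ys" by (simp only: graph_after_eq_hist_graph h)
    have "prob {\<omega> \<in> space M. hist (Suc n) \<omega> = hs}
        = prob {\<omega> \<in> space M. (\<forall>i\<in>{1..n}. S i \<omega> = h i) \<and> S (Suc n) \<omega> = A}"
      by (simp only: hs hist_Suc list.inject eq conj_commute)
    also have "\<dots> = prob {\<omega> \<in> space M. hist n \<omega> = ys} * pmf (kernel ys) A"
      unfolding S_law G eq ..
    also have "\<dots> = pmf (path_pmf kernel (Suc n)) hs"
      unfolding Suc.IH hs pmf_path_pmf_Cons ..
    finally show ?thesis .
  qed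
qed

sublocale path_process M kernel hist
proof unfold_locales
  show "finite (set_pmf (kernel xs))" if "xs \<in> set_pmf (path_pmf kernel n)" for n xs
    using interaction_history.finite_set_step[OF interaction_history[OF that]] .
  show "\<exists>x. hist (Suc n) \<omega> = x # hist n \<omega>" for n \<omega>
    by (simp add: hist_Suc)
  show meas: "hist n \<in> M \<rightarrow>\<^sub>M count_space UNIV" for n
    by (rule measurable_compose[OF hist_measurable']) simp
  show "distr M (count_space UNIV) (hist n) = measure_pmf (path_pmf kernel n)" for n
  \<comment> \<open>The type of histories is uncountable, but both measures are carried by the
    countable set \<open>lists N_sets\<close>, where agreement on singletons suffices.\<close>
  proof (rule measure_eqI_countable_AE)
    show "countable (lists N_sets)" by (intro countable_lists countable_N_sets)
    show "AE xs in distr M (count_space UNIV) (hist n). xs \<in> lists N_sets"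
      using measurable_space[OF hist_measurable'] by (subst AE_distr_iff[OF meas]) auto
    show "AE xs in path_pmf kernel n. xs \<in> lists N_sets"
      by (rule AE_pmfI) (auto dest: interaction_history interaction_history.history_sets)
    show "emeasure (distr M (count_space UNIV) (hist n)) {xs} = emeasure (path_pmf kernel n) {xs}" for xs
    proof -
      have "emeasure (distr M (count_space UNIV) (hist n)) {xs} = emeasure M {\<omega> \<in> space M. hist n \<omega> = xs}"
        by (subst emeasure_distr[OF meas]) (auto intro!: arg_cong[of _ _ "emeasure M"])
      then show ?thesis by (simp add: emeasure_eq_measure prob_hist emeasure_pmf_single)
    qed
  qed auto
qed

section \<open>Linear growth of the vertex set\<close>

lemma card_vertices_ge_path_sum:
  "hs \<in> set_pmf (path_pmf kernel n) \<Longrightarrow>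
   path_sum (\<lambda>hs A. of_bool (new_vertex (hist_graph N hs) \<in> A)) hs \<le> real (card (vertices (hist_graph N hs)))"
proof (induction n arbitrary: hs)
  case (Suc n)
  then obtain A xs where hs: "hs = A # xs" and xs: "xs \<in> set_pmf (path_pmf kernel n)"
    and A: "A \<in> set_pmf (kernel xs)" by auto
  interpret interaction_history N p q r xs by (rule interaction_history[OF xs])
  have V: "vertices (interact A G) = V \<union> A" by (simp add: interact_def)
  have "card V + of_bool (new_vertex G \<in> A) \<le> card (V \<union> A)"
  proof (cases "new_vertex G \<in> A")
    case True
    then have "card (insert (new_vertex G) V) \<le> card (V \<union> A)"
      using finite_V set_step[OF A] by (intro card_mono) auto
    then show ?thesis using True new_vertex_notin finite_V by simp
  qed (use finite_V set_step[OF A] in \<open>auto intro: card_mono\<close>)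
  then have "real (card V) + of_bool (new_vertex G \<in> A) \<le> real (card (V \<union> A))"
    by (metis of_nat_add of_nat_le_iff of_nat_of_bool)
  then show ?case using Suc.IH[OF xs] by (simp add: hs V)
qed simp

text \<open>\<open>path_sum_asymp_mean\<close> with exponent 1, applied to the indicators of new
  vertices, whose conditional mean is constantly p: their number is asymptotic to p n and bounds the
  number of vertices from below.\<close>

lemma AE_vertices_linear_growth:
  "AE \<omega> in M. \<exists>c::nat. \<forall>n. Suc n \<le> c * card (vertices (hist_graph N (hist n \<omega>)))"
proof -
  let ?f = "\<lambda>hs A. of_bool (new_vertex (hist_graph N hs) \<in> A) :: real"
  have mean: "mean kernel ?f hs = p" if "hs \<in> set_pmf (path_pmf kernel n)" for hs n
    using interaction_history.prob_new_vertex[OF interaction_history[OF that]] .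
  have "AE \<omega> in M. \<forall>L. (\<lambda>n. path_sum (\<lambda>xs _. mean kernel ?f xs) (hist n \<omega>) / real n powr 1) \<longlonglongrightarrow> L
     \<longrightarrow> (\<lambda>n. path_sum ?f (hist n \<omega>) / real n powr 1) \<longlonglongrightarrow> L"
    by (rule path_sum_asymp_mean[where B = 1 and C = p]) (auto simp: mean)
  then show ?thesis using AE_hist
  proof eventually_elim
    case (elim \<omega>)
    have "path_sum (\<lambda>xs _. mean kernel ?f xs) (hist n \<omega>) = p * real n" for n
    proof (induction n)
      case (Suc n)
      then show ?case using mean[of "hist n \<omega>" n] elim(2) by (simp add: hist_Suc algebra_simps)
    qed simp
    moreover have "(\<lambda>n. p * real n / real n powr 1) \<longlonglongrightarrow> p" by real_asymp
    ultimately have "(\<lambda>n. path_sum ?f (hist n \<omega>) / real n powr 1) \<longlonglongrightarrow> p"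
      using elim(1) by simp
    then have "\<forall>\<^sub>F n in sequentially. path_sum ?f (hist n \<omega>) / real n powr 1 > p / 2"
      using p_range by (intro order_tendstoD) auto
    then obtain n0 where n0: "\<And>n. n \<ge> n0 \<Longrightarrow> path_sum ?f (hist n \<omega>) / real n powr 1 > p / 2"
      by (auto simp: eventually_sequentially)
    let ?V = "\<lambda>n. card (vertices (hist_graph N (hist n \<omega>)))"
    have pos: "?V n \<ge> 1" for n
      using interaction_history.card_V_ge[OF interaction_history, of "hist n \<omega>" n] elim(2) N_ge_3 by auto
    \<comment> \<open>Late times satisfy |V| > p n / 2, so 4 / p gives 2 n, which is at least n + 1
      for n >= 1. Early times are covered by \<open>Suc n0\<close>, as V is nonempty.\<close>
    obtain c :: nat where c: "real c \<ge> 4 / p" using real_arch_simple by blast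
    have "Suc n \<le> max c (Suc n0) * ?V n" for n
    proof (cases "n \<ge> max 1 n0")
      case True
      then have "p / 2 * real n < path_sum ?f (hist n \<omega>)"
        using n0[of n] by (simp add: pos_less_divide_eq)
      also have "\<dots> \<le> real (?V n)"
        using card_vertices_ge_path_sum elim(2) by blast
      finally have "real n * 2 \<le> 4 / p * real (?V n)" using p_range by (simp add: field_simps)
      also have "\<dots> \<le> real c * real (?V n)" using c by (intro mult_right_mono) auto
      finally have "2 * n \<le> c * ?V n" by (metis mult.commute of_nat_le_iff of_nat_mult of_nat_numeral)
      also have "\<dots> \<le> max c (Suc n0) * ?V n" by (intro mult_right_mono) auto
      finally show ?thesis using True by linarith
    next
      case False
      then have "Suc n * 1 \<le> max c (Suc n0) * ?V n" using pos[of n] by (intro mult_mono) auto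
      then show ?thesis by simp
    qed
    then show ?case by blast
  qed
qed

section \<open>Truncated degree gains and the asymptotics of the degree\<close>

abbreviation "\<alpha> \<equiv> alpha N p q r"

lemma alpha2_nonneg: "alpha2 N p r \<ge> 0"
  using p_range r_range N_ge_3 by (simp add: alpha2_def)

text \<open>On histories satisfying \<open>good_history c v\<close> the conditional mean of the degree gain of \<open>v\<close> is at
  most a constant times \<open>(n + 1)\<^sup>\<alpha>\<^sup>-\<^sup>1\<close>; almost every trajectory satisfies it for a suitable \<open>c\<close> at all
  times at which \<open>v\<close> is present.\<close>

definition good_history :: "nat \<Rightarrow> int \<Rightarrow> int set list \<Rightarrow> bool" where
  "good_history c v hs \<longleftrightarrow> v \<in> vertices (hist_graph N hs)
     \<and> real (vertex_weight (hist_graph N hs) v) \<le> real c * real (Suc (length hs)) powr \<alpha>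
     \<and> Suc (length hs) \<le> c * card (vertices (hist_graph N hs))"

text \<open>The cut-off looks at the past only, so conditional means are either those of the true
  gain or 0, and the bound required by \<open>path_sum_asymp_mean\<close> holds at every history of
  positive probability.\<close>

definition truncated_gain :: "nat \<Rightarrow> int \<Rightarrow> int set list \<Rightarrow> int set \<Rightarrow> real" where
  "truncated_gain c v hs A = (if good_history c v hs then real (degree_gain (hist_graph N hs) v A) else 0)"

lemma mean_truncated_gain:
  assumes hs: "hs \<in> set_pmf (path_pmf kernel n)" and good: "good_history c v hs"
  defines "\<mu> \<equiv> alpha2 N p r * real (vertex_weight (hist_graph N hs) v) / real (Suc n)"
  shows "\<mu> \<le> mean kernel (truncated_gain c v) hs"
    and "mean kernel (truncated_gain c v) hs \<le> \<mu> + (real N)\<^sup>2 * real c / real (Suc n)"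
proof -
  interpret interaction_history N p q r hs by (rule interaction_history[OF hs])
  have len: "length hs = n" by (rule length_path_pmf[OF hs])
  have v: "v \<in> V" and card: "Suc n \<le> c * card V" using good len by (auto simp: good_history_def)
  have eq: "mean kernel (truncated_gain c v) hs = measure_pmf.expectation step (\<lambda>A. real (degree_gain G v A))"
    using good by (intro Bochner_Integration.integral_cong refl) (simp add: truncated_gain_def)
  show "\<mu> \<le> mean kernel (truncated_gain c v) hs"
    unfolding eq \<mu>_def using mean_degree_gain(1)[OF v] len by simp
  have "card V > 0" using card_V_ge N_ge_3 by simp
  then have "(real N)\<^sup>2 / real (card V) = (real N)\<^sup>2 * (1 / real (card V))" by simp
  also have "1 / real (card V) \<le> real c / real (Suc n)"
    using \<open>card V > 0\<close> card by (simp add: divide_simps del: of_nat_Suc) (metis mult.commute of_nat_le_iff of_nat_mult)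
  finally have "(real N)\<^sup>2 / real (card V) \<le> (real N)\<^sup>2 * real c / real (Suc n)"
    by (simp add: mult_left_mono)
  then show "mean kernel (truncated_gain c v) hs \<le> \<mu> + (real N)\<^sup>2 * real c / real (Suc n)"
    unfolding eq \<mu>_def using mean_degree_gain(2)[OF v] len by simp
qed

text \<open>The level c will depend on the trajectory. Since it is a natural number, the countably
  many exceptional null sets can be united, which puts the quantifier over c inside the almost sure
  statement.\<close>

lemma truncated_gain_asymp_mean:
  assumes \<alpha>: "\<alpha> > 0"
  shows "AE \<omega> in M. \<forall>c L. (\<lambda>n. path_sum (\<lambda>xs _. mean kernel (truncated_gain c v) xs) (hist n \<omega>) / real n powr \<alpha>) \<longlonglongrightarrow> L
     \<longrightarrow> (\<lambda>n. path_sum (truncated_gain c v) (hist n \<omega>) / real n powr \<alpha>) \<longlonglongrightarrow> L"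
proof (subst AE_all_countable, intro allI path_sum_asymp_mean \<alpha>)
  fix c n hs A
  assume hs: "hs \<in> set_pmf (path_pmf kernel n)" and A: "A \<in> set_pmf (kernel hs)"
  interpret interaction_history N p q r hs by (rule interaction_history[OF hs])
  have "degree_gain G v A \<le> N"
    using degree_gain_le[OF set_step(1)[OF A], of v] set_step(2)[OF A] by (cases "v \<in> A") auto
  then show "0 \<le> truncated_gain c v hs A \<and> truncated_gain c v hs A \<le> real N"
    by (simp add: truncated_gain_def)
next
  fix c n hs
  assume hs: "hs \<in> set_pmf (path_pmf kernel n)"
  let ?s = "real (Suc n)"
  let ?C = "alpha2 N p r * real c + (real N)\<^sup>2 * real c"
  show "mean kernel (truncated_gain c v) hs \<le> ?C * ?s powr (\<alpha> - 1)"
  proof (cases "good_history c v hs")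
    case True
    have "real (vertex_weight (hist_graph N hs) v) \<le> real c * ?s powr \<alpha>"
      using True length_path_pmf[OF hs] by (simp add: good_history_def)
    then have "alpha2 N p r * real (vertex_weight (hist_graph N hs) v) / ?s
        \<le> alpha2 N p r * (real c * ?s powr \<alpha>) / ?s"
      using alpha2_nonneg by (intro divide_right_mono mult_left_mono) auto
    also have "\<dots> = alpha2 N p r * real c * ?s powr (\<alpha> - 1)"
      by (simp add: powr_diff)
    finally have 1: "alpha2 N p r * real (vertex_weight (hist_graph N hs) v) / ?s
        \<le> alpha2 N p r * real c * ?s powr (\<alpha> - 1)" .
    \<comment> \<open>As \<alpha> > 0, the O(1/n) contribution of the uniform choices fits under the
      bound of order n^(\<alpha> - 1).\<close>
    have "?s powr (-1) \<le> ?s powr (\<alpha> - 1)"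
      using \<alpha> by (intro powr_mono) auto
    then have "(real N)\<^sup>2 * real c * (1 / ?s) \<le> (real N)\<^sup>2 * real c * ?s powr (\<alpha> - 1)"
      by (intro mult_left_mono) (auto simp: powr_minus_divide)
    then show ?thesis
      using mean_truncated_gain(2)[OF hs True] 1 by (simp add: distrib_right del: of_nat_Suc)
  next
    case False
    then have "truncated_gain c v hs = (\<lambda>_. 0)" by (intro ext) (simp add: truncated_gain_def)
    then show ?thesis using alpha2_nonneg by simp
  qed
qed

lemma vertex_weight_outside: "v \<notin> vertices (hist_graph N hs) \<Longrightarrow> vertex_weight (hist_graph N hs) v = 0"
  by (auto simp: vertex_weight_def weight_hist_graph vertices_hist_graph)

text \<open>All randomness sits in the hypotheses, so a single trajectory is treated: its histories
  are good from some time on, the means are then known asymptotically, and \<open>lln\<close> passes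
  to the gains.\<close>

lemma degree_asymp:
  assumes hist: "\<And>n. hist n \<omega> \<in> set_pmf (path_pmf kernel n)"
    and growth: "\<And>n. Suc n \<le> c0 * card (vertices (hist_graph N (hist n \<omega>)))"
    and \<alpha>: "\<alpha> > 0"
    and lln: "\<And>c L. (\<lambda>n. path_sum (\<lambda>xs _. mean kernel (truncated_gain c v) xs) (hist n \<omega>) / real n powr \<alpha>) \<longlonglongrightarrow> L
     \<Longrightarrow> (\<lambda>n. path_sum (truncated_gain c v) (hist n \<omega>) / real n powr \<alpha>) \<longlonglongrightarrow> L"
    and W: "(\<lambda>n. real (vertex_weight (hist_graph N (hist n \<omega>)) v) / real n powr \<alpha>) \<longlonglongrightarrow> l" and l: "l > 0"
  shows "(\<lambda>n. real (vertex_degree (hist_graph N (hist n \<omega>)) v) / real n powr \<alpha>) \<longlonglongrightarrow> alpha2 N p r / \<alpha> * l"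
proof -
  let ?G = "\<lambda>n. hist_graph N (hist n \<omega>)"
  let ?w = "\<lambda>n. real (vertex_weight (?G n) v)"
  let ?D = "\<lambda>n. real (vertex_degree (?G n) v)"
  \<comment> \<open>A positive limit forces positive weight eventually, hence the presence of v from
    \<open>n0\<close> on.\<close>
  have "\<forall>\<^sub>F n in sequentially. ?w n / real n powr \<alpha> > 0"
    using W l by (rule order_tendstoD)
  then obtain n0 where "\<And>n. n \<ge> n0 \<Longrightarrow> ?w n / real n powr \<alpha> > 0"
    by (auto simp: eventually_sequentially)
  then have v: "v \<in> vertices (?G n)" if "n \<ge> n0" for n
    using that vertex_weight_outside by fastforce
  \<comment> \<open>The conditional means have denominator n + 1, so the weight is renormalised
    accordingly.\<close>
  have W': "(\<lambda>n. ?w n / real (Suc n) powr \<alpha>) \<longlonglongrightarrow> l"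
  proof -
    have "(\<lambda>n. real n powr \<alpha> / real (Suc n) powr \<alpha>) \<longlonglongrightarrow> 1" using \<alpha> by real_asymp
    from tendsto_mult[OF W this]
    have "(\<lambda>n. ?w n / real n powr \<alpha> * (real n powr \<alpha> / real (Suc n) powr \<alpha>)) \<longlonglongrightarrow> l" by simp
    moreover have "\<forall>\<^sub>F n in sequentially. ?w n / real n powr \<alpha> * (real n powr \<alpha> / real (Suc n) powr \<alpha>) = ?w n / real (Suc n) powr \<alpha>"
      using eventually_gt_at_top[of 0] by eventually_elim simp
    ultimately show ?thesis by (rule Lim_transform_eventually)
  qed
  obtain b where b: "\<And>n. \<bar>?w n / real (Suc n) powr \<alpha>\<bar> \<le> b"
    using convergent_imp_Bseq[OF convergentI[OF W']] unfolding Bseq_def real_norm_def by blast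
  \<comment> \<open>One level serves both the weight bound \<open>b\<close> and the vertex growth
    constant \<open>c0\<close>.\<close>
  obtain c :: nat where c: "real c \<ge> max b (real c0)" using real_arch_simple by blast
  have good: "good_history c v (hist n \<omega>)" if "n \<ge> n0" for n
  proof -
    have "?w n / real (Suc n) powr \<alpha> \<le> real c"
      using b[of n] c by (meson abs_le_D1 max.boundedE order_trans)
    then have "?w n \<le> real c * real (Suc n) powr \<alpha>"
      by (simp add: pos_divide_le_eq)
    moreover have "c0 \<le> c" using c by simp
    then have "Suc n \<le> c * card (vertices (?G n))"
      using growth[of n] by (meson le_trans mult_le_mono1)
    ultimately show ?thesis using v[OF that] by (simp add: good_history_def length_path_pmf[OF hist])
  qed
  let ?a = "\<lambda>n. mean kernel (truncated_gain c v) (hist n \<omega>)"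
  have s: "x / real (Suc n) * real (Suc n) powr (1 - \<alpha>) = x / real (Suc n) powr \<alpha>" for n x
    by (simp add: powr_diff)
  have "(\<lambda>n. ?a n * real (Suc n) powr (1 - \<alpha>)) \<longlonglongrightarrow> alpha2 N p r * l"
  proof (rule tendsto_sandwich)
    show "\<forall>\<^sub>F n in sequentially. alpha2 N p r * (?w n / real (Suc n) powr \<alpha>) \<le> ?a n * real (Suc n) powr (1 - \<alpha>)"
      using eventually_ge_at_top[of n0]
    proof eventually_elim
      case (elim n)
      from mult_right_mono[OF mean_truncated_gain(1)[OF hist good[OF elim]], of "real (Suc n) powr (1 - \<alpha>)"]
      show ?case unfolding s by simp
    qed
    show "\<forall>\<^sub>F n in sequentially. ?a n * real (Suc n) powr (1 - \<alpha>)
        \<le> alpha2 N p r * (?w n / real (Suc n) powr \<alpha>) + (real N)\<^sup>2 * real c / real (Suc n) powr \<alpha>"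
      using eventually_ge_at_top[of n0]
    proof eventually_elim
      case (elim n)
      from mult_right_mono[OF mean_truncated_gain(2)[OF hist good[OF elim]], of "real (Suc n) powr (1 - \<alpha>)"]
      show ?case unfolding distrib_right s by simp
    qed
    show "(\<lambda>n. alpha2 N p r * (?w n / real (Suc n) powr \<alpha>)) \<longlonglongrightarrow> alpha2 N p r * l"
      by (intro tendsto_intros W')
    have "(\<lambda>n. (real N)\<^sup>2 * real c / real (Suc n) powr \<alpha>) \<longlonglongrightarrow> 0" using \<alpha> by real_asymp
    from tendsto_add[OF tendsto_mult[OF tendsto_const W'] this]
    show "(\<lambda>n. alpha2 N p r * (?w n / real (Suc n) powr \<alpha>) + (real N)\<^sup>2 * real c / real (Suc n) powr \<alpha>)
        \<longlonglongrightarrow> alpha2 N p r * l" by simp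
  qed
  \<comment> \<open>Summing means of order n^(\<alpha> - 1) brings in the division by
    \<alpha>.\<close>
  from tendsto_sum_div_powr[OF \<alpha> this]
  have "(\<lambda>n. (\<Sum>k<n. ?a k) / real n powr \<alpha>) \<longlonglongrightarrow> alpha2 N p r / \<alpha> * l" by simp
  moreover have "path_sum (\<lambda>xs _. mean kernel (truncated_gain c v) xs) (hist n \<omega>) = (\<Sum>k<n. ?a k)" for n
    by (induction n) (auto simp: hist_Suc)
  ultimately have Y: "(\<lambda>n. path_sum (truncated_gain c v) (hist n \<omega>) / real n powr \<alpha>) \<longlonglongrightarrow> alpha2 N p r / \<alpha> * l"
    by (intro lln) simp
  let ?Y = "\<lambda>n. path_sum (truncated_gain c v) (hist n \<omega>)"
  \<comment> \<open>From \<open>n0\<close> on the truncation is inactive, so both sequences have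
    equal increments and their difference stays frozen; it vanishes after division by
    n^\<alpha>.\<close>
  have const: "?D n = ?Y n + (?D n0 - ?Y n0)" if "n \<ge> n0" for n
    using that
  proof (induction rule: dec_induct)
    case (step n)
    interpret interaction_history N p q r "hist n \<omega>" by (rule interaction_history[OF hist])
    have "S (Suc n) \<omega> \<in> set_pmf (kernel (hist n \<omega>))"
      using hist[of "Suc n"] by (auto simp: hist_Suc)
    from degree_interact[OF set_step(1)[OF this], of v]
    show ?case using step.IH good[OF step.hyps(1)] by (simp add: hist_Suc truncated_gain_def)
  qed simp
  have "(\<lambda>n. x / real n powr \<alpha>) \<longlonglongrightarrow> 0" for x using \<alpha> by real_asymp
  from tendsto_add[OF Y this]
  have "(\<lambda>n. (?Y n + (?D n0 - ?Y n0)) / real n powr \<alpha>) \<longlonglongrightarrow> alpha2 N p r / \<alpha> * l"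
    by (simp add: add_divide_distrib)
  moreover have "\<forall>\<^sub>F n in sequentially. (?Y n + (?D n0 - ?Y n0)) / real n powr \<alpha> = ?D n / real n powr \<alpha>"
    using eventually_ge_at_top[of n0] 
    by eventually_elim (rule arg_cong2[where f = "(/)", OF const[symmetric] refl])
  ultimately show ?thesis by (rule Lim_transform_eventually)
qed

end

theorem theorem2p2:
  fixes M :: "'a measure" and N :: nat and p q r :: real
    and S :: "nat \<Rightarrow> 'a \<Rightarrow> int set" and j :: nat and \<gamma> :: "'a \<Rightarrow> real"
  assumes "N_interactions_model M N p q r S"
    and "alpha N p q r > 0"
    and "\<gamma> \<in> borel_measurable M"
    and "AE \<omega> in M. \<gamma> \<omega> > 0"
    and "AE \<omega> in M. (\<lambda>n. real n powr (- alpha N p q r) * real (W N S n j \<omega>))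
           \<longlonglongrightarrow> 1 / Gamma (1 + alpha N p q r) * \<gamma> \<omega>"
  shows "AE \<omega> in M. (\<lambda>n. real n powr (- alpha N p q r) * real (D N S n j \<omega>))
           \<longlonglongrightarrow> 1 / Gamma (1 + alpha N p q r) * (alpha2 N p r / alpha N p q r) * \<gamma> \<omega>"
proof -
  interpret N_interactions_model M N p q r S by fact
  show ?thesis
    using assms(4,5) AE_hist AE_vertices_linear_growth truncated_gain_asymp_mean[OF assms(2), of "int j"]
  proof eventually_elim
    case (elim \<omega>)
    obtain c where c: "\<And>n. Suc n \<le> c * card (vertices (hist_graph N (hist n \<omega>)))" using elim(4) by blast
    \<comment> \<open>Positivity of the limit of the normalised weight is what
      \<open>degree_asymp\<close> uses to know that the vertex appears.\<close>
    have "Gamma (1 + \<alpha>) > 0" using assms(2) by (intro Gamma_real_pos) auto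
    then have pos: "1 / Gamma (1 + \<alpha>) * \<gamma> \<omega> > 0" using elim(1) by simp
    have W: "(\<lambda>n. real (vertex_weight (hist_graph N (hist n \<omega>)) (int j)) / real n powr \<alpha>)
        \<longlonglongrightarrow> 1 / Gamma (1 + \<alpha>) * \<gamma> \<omega>"
      using elim(2) by (simp add: W_def graph_after_S powr_minus_divide)
    have "(\<lambda>n. real (vertex_degree (hist_graph N (hist n \<omega>)) (int j)) / real n powr \<alpha>)
        \<longlonglongrightarrow> alpha2 N p r / \<alpha> * (1 / Gamma (1 + \<alpha>) * \<gamma> \<omega>)"
      by (rule degree_asymp[OF _ c assms(2) _ W pos]) (use elim(3,5) in blast)+
    then show ?case by (simp add: D_def graph_after_S powr_minus_divide mult_ac)
  qed
qed

end
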